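(* Let $\Gamma=\Gamma_{D^-}$ be the coset graph of the additive code $D^-$ defined in the context. The automorphism group of $\Gamma$ has order $2^{10}\cdot54$, acts transitively on the vertices, and has two orbits on the edges, of sizes $2^9\cdot6$ and $2^9\cdot27$. The stabilizer of a vertex has a structure of type $(C_9\rtimes C_3)\rtimes C_2$. For an element $g$ of the automorphism group of order $p$, the subgraph induced on the set of vertices fixed by $g$ is, up to isomorphism, one of the following: (i) the whole graph, $p=1$; (ii) the null graph, $p=2$; (iii) the disjoint union of $8$ complete graphs of order $4$, $p=2$; (iv) the edge-free graph on $4$ vertices, $p=3$; (v) the Hamming graph $H(2,4)$, $p=3$; (vi) the edge-free graph on $2$ vertices, $p=6$; (vii) the one-vertex graph, $p=9$; (viii) the complete graph of order $4$, $p=9$.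
   Context: $\mathbb{F}_4=\{0,1,\omega,\omega^2\}$ with $\omega^2=\omega+1$. The coset graph $\Gamma_C$ of an additive code $C\subseteq\mathbb{F}_4^n$ (additive subgroup) has as vertices the cosets $x+C$, two cosets adjacent if their difference contains a vector of Hamming weight $1$. $H(2,4)$ is the graph on $\mathbb{F}_4^2$ with vectors adjacent iff they differ in exactly one coordinate. $D^-$ is the $\mathbb{F}_2$-span of the following $12$ vectors of $\mathbb{F}_4^{11}$: $(0,0,0,0,0,\omega^2,\omega^2,0,\omega,1,\omega)$, $(0,0,0,0,0,\omega,0,\omega,\omega,\omega,1)$, $(1,0,0,0,0,1,0,1,\omega^2,\omega^2,1)$, $(\omega,0,0,0,0,0,\omega,1,\omega,\omega,\omega)$, $(0,1,0,0,0,0,1,1,1,\omega^2,\omega^2)$, $(0,\omega,0,0,0,\omega^2,1,\omega^2,\omega,\omega,0)$, $(0,0,1,0,0,\omega,\omega,1,1,0,1)$, $(0,0,\omega,0,0,\omega,1,\omega,\omega^2,\omega^2,0)$, $(0,0,0,1,0,\omega,\omega,\omega,0,1,\omega)$, $(0,0,0,\omega,0,\omega^2,1,1,\omega^2,0,\omega)$, $(0,0,0,0,1,\omega^2,\omega^2,\omega^2,1,0,\omega^2)$, $(0,0,0,0,\omega,\omega,1,0,1,\omega,\omega)$. $\Gamma_{D^-}$ has $2^{10}$ vertices.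
   Formalization: In item (ii) the null graph is allowed with p in {2,4,6,12,18} instead of only p=2, since p=2 alone is false: an involution fixing a vertex, composed with a translation by a coset it does not fix, has order 4, which no item covers. *)

theory Defs
  imports "HOL-Analysis.Cartesian_Space" "HOL-Algebra.Group_Action" "HOL-Algebra.Elementary_Groups"
    "HOL-Algebra.Multiplicative_Group"
begin

section \<open>The field with four elements\<close>

datatype f4 = F0 | F1 | Fw | Fw2

instantiation f4 :: field
begin

definition zero_f4 :: f4 where "0 = F0"

definition one_f4 :: f4 where "1 = F1"

fun plus_f4 :: "f4 \<Rightarrow> f4 \<Rightarrow> f4" where
  "F0 + y = y"
| "x + F0 = x"
| "F1 + F1 = F0" | "F1 + Fw = Fw2" | "F1 + Fw2 = Fw"
| "Fw + F1 = Fw2" | "Fw + Fw = F0" | "Fw + Fw2 = F1"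
| "Fw2 + F1 = Fw" | "Fw2 + Fw = F1" | "Fw2 + Fw2 = F0"

definition uminus_f4 :: "f4 \<Rightarrow> f4" where "- x = x" for x :: f4

definition minus_f4 :: "f4 \<Rightarrow> f4 \<Rightarrow> f4" where "x - y = x + y" for x y :: f4

fun times_f4 :: "f4 \<Rightarrow> f4 \<Rightarrow> f4" where
  "F0 * y = F0"
| "x * F0 = F0"
| "F1 * y = y"
| "x * F1 = x"
| "Fw * Fw = Fw2" | "Fw * Fw2 = F1"
| "Fw2 * Fw = F1" | "Fw2 * Fw2 = Fw"

fun inverse_f4 :: "f4 \<Rightarrow> f4" where
  "inverse F0 = F0" | "inverse F1 = F1" | "inverse Fw = Fw2" | "inverse Fw2 = Fw"

definition divide_f4 :: "f4 \<Rightarrow> f4 \<Rightarrow> f4" where "x div y = x * inverse y" for x y :: f4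

instance
proof
  fix a b c :: f4
  show "a * b * c = a * (b * c)" by (cases a; cases b; cases c) simp_all
  show "a * b = b * a" by (cases a; cases b) simp_all
  show "1 * a = a" by (cases a) (simp_all add: one_f4_def)
  show "a + b + c = a + (b + c)" by (cases a; cases b; cases c) simp_all
  show "a + b = b + a" by (cases a; cases b) simp_all
  show "0 + a = a" by (simp add: zero_f4_def)
  show "- a + a = 0" by (cases a) (simp_all add: uminus_f4_def zero_f4_def)
  show "a - b = a + - b" by (simp add: uminus_f4_def minus_f4_def)
  show "(a + b) * c = a * c + b * c" by (cases a; cases b; cases c) simp_all
  show "(0::f4) \<noteq> 1" by (simp add: zero_f4_def one_f4_def)
  show "a \<noteq> 0 \<Longrightarrow> inverse a * a = 1" by (cases a) (simp_all add: zero_f4_def one_f4_def)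
  show "a div b = a * inverse b" by (simp add: divide_f4_def)
  show "inverse (0::f4) = 0" by (simp add: zero_f4_def)
qed

end

abbreviation omega :: f4 (\<open>\<omega>\<close>) where "\<omega> \<equiv> Fw"

lemma UNIV_f4: "(UNIV :: f4 set) = {0, 1, \<omega>, \<omega>\<^sup>2}"
  by (auto simp: zero_f4_def one_f4_def power2_eq_square intro: f4.exhaust)

lemma omega_squared: "\<omega>\<^sup>2 = \<omega> + 1"
  by (simp add: one_f4_def power2_eq_square)

instance f4 :: finite
  by standard (simp add: UNIV_f4)

section \<open>Simple graphs\<close>

text \<open>A graph is a vertex set together with a set of edges, an edge being the unordered pair
  of its two distinct end vertices.\<close>

type_synonym 'a graph = "'a set \<times> 'a set set"

abbreviation verts :: "'a graph \<Rightarrow> 'a set" where "verts \<equiv> fst"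

abbreviation edges :: "'a graph \<Rightarrow> 'a set set" where "edges \<equiv> snd"

definition graph_of :: "'a set \<Rightarrow> ('a \<Rightarrow> 'a \<Rightarrow> bool) \<Rightarrow> 'a graph" where
  "graph_of V adj = (V, {{u, v} | u v. u \<in> V \<and> v \<in> V \<and> u \<noteq> v \<and> adj u v})"

definition graph_isomorphism :: "'a graph \<Rightarrow> 'b graph \<Rightarrow> ('a \<Rightarrow> 'b) \<Rightarrow> bool" where
  "graph_isomorphism \<Gamma> \<Delta> f \<longleftrightarrow> bij_betw f (verts \<Gamma>) (verts \<Delta>) \<and>
     (\<forall>u\<in>verts \<Gamma>. \<forall>v\<in>verts \<Gamma>. {u, v} \<in> edges \<Gamma> \<longleftrightarrow> {f u, f v} \<in> edges \<Delta>)"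

definition graph_isomorphic :: "'a graph \<Rightarrow> 'b graph \<Rightarrow> bool" where
  "graph_isomorphic \<Gamma> \<Delta> \<longleftrightarrow> (\<exists>f. graph_isomorphism \<Gamma> \<Delta> f)"

definition induced_subgraph :: "'a graph \<Rightarrow> 'a set \<Rightarrow> 'a graph" where
  "induced_subgraph \<Gamma> S = (S, {e \<in> edges \<Gamma>. e \<subseteq> S})"

definition graph_aut :: "'a graph \<Rightarrow> ('a \<Rightarrow> 'a) monoid" where
  "graph_aut \<Gamma> = (BijGroup (verts \<Gamma>))
     \<lparr>carrier := {f \<in> Bij (verts \<Gamma>). graph_isomorphism \<Gamma> \<Gamma> f}\<rparr>"

definition edgeless_graph :: "nat \<Rightarrow> nat graph" where
  "edgeless_graph n = graph_of {..<n} (\<lambda>_ _. False)"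

abbreviation null_graph :: "nat graph" where
  "null_graph \<equiv> edgeless_graph 0"

definition complete_graph :: "nat \<Rightarrow> nat graph" where
  "complete_graph n = graph_of {..<n} (\<lambda>_ _. True)"

definition disjoint_copies :: "nat \<Rightarrow> 'a graph \<Rightarrow> (nat \<times> 'a) graph" where
  "disjoint_copies k \<Gamma> = graph_of ({..<k} \<times> verts \<Gamma>)
     (\<lambda>(i, u) (j, v). i = j \<and> {u, v} \<in> edges \<Gamma>)"

section \<open>Additive codes and their coset graphs\<close>

definition hamming_weight :: "f4 ^ 'n \<Rightarrow> nat" where
  "hamming_weight x = card {i. x $ i \<noteq> 0}"

text \<open>The Hamming graph \<open>H(n,4)\<close> for \<open>n = CARD('n)\<close>.\<close>

definition hamming_graph :: "(f4 ^ 'n) graph" where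
  "hamming_graph = graph_of UNIV (\<lambda>x y. card {i. x $ i \<noteq> y $ i} = 1)"

definition coset_graph :: "(f4 ^ 'n) set \<Rightarrow> (f4 ^ 'n) set graph" where
  "coset_graph C = graph_of (range (\<lambda>x. (+) x ` C))
     (\<lambda>X Y. \<exists>x\<in>X. \<exists>y\<in>Y. hamming_weight (x - y) = 1)"

text \<open>The scalars \<open>0\<close> and \<open>1\<close> form the prime subfield \<open>F\<^sub>2\<close>.\<close>

definition F2_span :: "(f4 ^ 'n) set \<Rightarrow> (f4 ^ 'n) set" where
  "F2_span B = {(\<Sum>b\<in>B. c b *s b) | c. \<forall>b\<in>B. c b \<in> {0, 1}}"

definition D_minus :: "(f4 ^ 11) set" where
  "D_minus = F2_span
    {vector [0, 0, 0, 0, 0, \<omega>\<^sup>2, \<omega>\<^sup>2, 0, \<omega>, 1, \<omega>],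
     vector [0, 0, 0, 0, 0, \<omega>, 0, \<omega>, \<omega>, \<omega>, 1],
     vector [1, 0, 0, 0, 0, 1, 0, 1, \<omega>\<^sup>2, \<omega>\<^sup>2, 1],
     vector [\<omega>, 0, 0, 0, 0, 0, \<omega>, 1, \<omega>, \<omega>, \<omega>],
     vector [0, 1, 0, 0, 0, 0, 1, 1, 1, \<omega>\<^sup>2, \<omega>\<^sup>2],
     vector [0, \<omega>, 0, 0, 0, \<omega>\<^sup>2, 1, \<omega>\<^sup>2, \<omega>, \<omega>, 0],
     vector [0, 0, 1, 0, 0, \<omega>, \<omega>, 1, 1, 0, 1],
     vector [0, 0, \<omega>, 0, 0, \<omega>, 1, \<omega>, \<omega>\<^sup>2, \<omega>\<^sup>2, 0],
     vector [0, 0, 0, 1, 0, \<omega>, \<omega>, \<omega>, 0, 1, \<omega>],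
     vector [0, 0, 0, \<omega>, 0, \<omega>\<^sup>2, 1, 1, \<omega>\<^sup>2, 0, \<omega>],
     vector [0, 0, 0, 0, 1, \<omega>\<^sup>2, \<omega>\<^sup>2, \<omega>\<^sup>2, 1, 0, \<omega>\<^sup>2],
     vector [0, 0, 0, 0, \<omega>, \<omega>, 1, 0, 1, \<omega>, \<omega>]}"

section \<open>Semidirect products\<close>

text \<open>\<open>G = N \<rtimes> H\<close> as an inner semidirect product. As usual in descriptions of the structure of
  a group, \<open>\<rtimes>\<close> is understood to be different from \<open>\<times>\<close>: that \<open>H\<close> is not normal says that it does
  not act trivially on \<open>N\<close>.\<close>

definition inner_semidirect :: "('a, 'm) monoid_scheme \<Rightarrow> 'a set \<Rightarrow> 'a set \<Rightarrow> bool" where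
  "inner_semidirect G N H \<longleftrightarrow> N \<lhd> G \<and> subgroup H G \<and> \<not> H \<lhd> G \<and>
     N \<inter> H = {\<one>\<^bsub>G\<^esub>} \<and> N <#>\<^bsub>G\<^esub> H = carrier G"

definition type_C9_C3_C2 :: "('a, 'm) monoid_scheme \<Rightarrow> bool" where
  "type_C9_C3_C2 G \<longleftrightarrow> (\<exists>K Q N P.
     inner_semidirect G K Q \<and> inner_semidirect (G\<lparr>carrier := K\<rparr>) N P \<and>
     G\<lparr>carrier := N\<rparr> \<cong> integer_mod_group 9 \<and>
     G\<lparr>carrier := P\<rparr> \<cong> integer_mod_group 3 \<and>
     G\<lparr>carrier := Q\<rparr> \<cong> integer_mod_group 2)"

end

theory Submission
  imports Defs "HOL-Number_Theory.Cong"
begin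

text \<open>
  The cosets of \<open>D_minus\<close> are the vectors of a 10-dimensional space over \<open>F\<^sub>2\<close>, and the coset graph is the
  Cayley graph of this space with respect to the 33 syndromes of vectors of weight 1, which form 11
  lines. Since \<open>D_minus\<close> has minimum distance 5, two vertices \<open>s\<close>, \<open>t\<close> at distance 2 that are adjacent to
  \<open>0\<close> have only \<open>0\<close> and \<open>s + t\<close> as common neighbours. An automorphism that fixes \<open>0\<close> is therefore
  additive on such sums, and applying this at every vertex shows that it is linear: all automorphisms
  are affine.

  The linear maps that permute the 33 syndromes are determined by a backtracking search. They preserve
  the set of vertices at distance 2 from \<open>0\<close>, and already the images of two lines leave few
  possibilities for a third one. The result is the group generated by two maps \<open>\<alpha>\<close>, \<open>\<delta>\<close> with
  \<open>\<alpha>\<^sup>9 = \<delta>\<^sup>6 = 1\<close> and \<open>\<delta>\<alpha> = \<alpha>\<^sup>2\<delta>\<close>, the holomorph of the cyclic group of order 9.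

  If an affine map fixes a vertex, it is conjugate under a translation to its linear part, whose fixed
  space is computed for a representative of each conjugacy class. If it fixes no vertex, its order is
  \<open>n\<close> or \<open>2n\<close>, where \<open>n\<close> is the order of the linear part, and it is even because the centroid of an orbit
  of odd length would be fixed.
\<close>

section \<open>The holomorph of the cyclic group of order 9\<close>

text \<open>The concrete facts about the 33 points are decided by \<open>code_simp\<close>, by
  rewriting that the kernel checks. This cost shapes the computations and is why the search does not
  enumerate the whole stabilizer. Products of \<alpha> and \<delta> already carry one of the two
  points \<open>base27\<close>, \<open>base6\<close> to any given point, so it suffices to find the
  linear maps sending \<open>base27\<close> to itself or to \<open>base6\<close>. The former are the
  identity and \<open>\<delta>\<^sup>3\<close>, the latter do not exist; hence the points fall into
  orbits of lengths 27 and 6. Translations are automorphisms, so up to translation an edge is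
  determined by the difference of its ends, and the two orbits of points yield the two orbits of
  edges. The exponent 2 in \<open>\<delta>\<alpha> = \<alpha>\<^sup>2\<delta>\<close> generates the
  units modulo 9. With the normal form \<open>\<alpha>\<^sup>i\<delta>\<^sup>k\<close>, both the
  semidirect decomposition and the conjugacy classes become congruences between exponents.\<close>

lemma (in group) cyclic_powers_iso_integer_mod_group:
  assumes x: "x \<in> carrier G" and n: "n > 0"
    and pow: "\<And>i j::nat. x [^] i = x [^] j \<longleftrightarrow> [i = j] (mod n)"
  shows "G\<lparr>carrier := range (\<lambda>i::nat. x [^] i)\<rparr> \<cong> integer_mod_group n"
proof -
  let ?f = "\<lambda>k. x [^] nat k" and ?C = "G\<lparr>carrier := range (\<lambda>i::nat. x [^] i)\<rparr>"
  have "x [^] nat ((k + l) mod int n) = x [^] nat k \<otimes> x [^] nat l" if "0 \<le> k" "0 \<le> l" for k l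
  proof -
    have "nat ((k + l) mod int n) = (nat k + nat l) mod n"
      using that n by (simp add: nat_mod_distrib nat_add_distrib)
    then have "[nat ((k + l) mod int n) = nat k + nat l] (mod n)"
      by (simp add: cong_def)
    then have "x [^] nat ((k + l) mod int n) = x [^] (nat k + nat l)"
      using pow by blast
    then show ?thesis using x by (simp add: nat_pow_mult)
  qed
  then have "?f \<in> hom (integer_mod_group n) ?C"
    using n by (auto simp: hom_def carrier_integer_mod_group)
  moreover have "bij_betw ?f {0..<int n} (range (\<lambda>i::nat. x [^] i))"
  proof -
    have "inj_on ?f {0..<int n}"
    proof (rule inj_onI)
      fix k l assume kl: "k \<in> {0..<int n}" "l \<in> {0..<int n}" and "?f k = ?f l"
      then have "[nat k = nat l] (mod n)" using pow by blast
      moreover have "nat k < n" "nat l < n" using kl by auto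
      ultimately have "nat k = nat l" by (simp add: cong_def)
      then show "k = l" using kl by auto
    qed
    moreover have "x [^] i \<in> ?f ` {0..<int n}" for i :: nat
    proof -
      have "x [^] i = ?f (int (i mod n))" by (simp add: pow cong_def)
      moreover have "int (i mod n) \<in> {0..<int n}" using n by simp
      ultimately show ?thesis by blast
    qed
    ultimately show ?thesis unfolding bij_betw_def by blast
  qed
  ultimately have "?f \<in> iso (integer_mod_group n) ?C"
    using n by (simp add: iso_def carrier_integer_mod_group)
  then show ?thesis
    using group.iso_sym[OF group_integer_mod_group] is_isoI by blast
qed

text \<open>Moving \<open>d\<close> past a power of \<open>a\<close> doubles the exponent, so every
  product has the form \<open>e i k\<close> and all claims about subgroups turn into arithmetic of
  \<open>i\<close> modulo 9 and \<open>k\<close> modulo 6.\<close>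

lemma (in group) type_C9_C3_C2_if_holomorph:
  fixes a d
  defines "e \<equiv> \<lambda>(i::nat) (k::nat). a [^] i \<otimes> d [^] k"
  assumes a: "a \<in> carrier G" and d: "d \<in> carrier G"
    and a9: "a [^] (9::nat) = \<one>" and d6: "d [^] (6::nat) = \<one>"
    and da: "d \<otimes> a = a [^] (2::nat) \<otimes> d"
    and gen: "\<And>x. x \<in> carrier G \<Longrightarrow> \<exists>i k. x = e i k" and ord: "order G = 54"
  shows "type_C9_C3_C2 G"
proof -
  have [simp]: "e i k \<in> carrier G" for i k using a d by (simp add: e_def)
  have da_pow: "d \<otimes> a [^] i = a [^] (2 * i) \<otimes> d" for i :: nat
  proof (induction i)
    case (Suc i)
    have "d \<otimes> a [^] Suc i = (d \<otimes> a [^] i) \<otimes> a" using a d by (simp add: m_assoc)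
    also have "\<dots> = a [^] (2 * i) \<otimes> (d \<otimes> a)" using a d by (simp add: Suc m_assoc)
    also have "\<dots> = a [^] (2 * Suc i) \<otimes> d"
      using a d by (simp add: da m_assoc[symmetric] nat_pow_mult)
    finally show ?case .
  qed (use a d in simp)
  have comm: "d [^] k \<otimes> a [^] i = a [^] (2 ^ k * i) \<otimes> d [^] k" for i k :: nat
  proof (induction k arbitrary: i)
    case (Suc k)
    have "d [^] Suc k \<otimes> a [^] i = d [^] k \<otimes> (d \<otimes> a [^] i)" using a d by (simp add: m_assoc)
    also have "\<dots> = (d [^] k \<otimes> a [^] (2 * i)) \<otimes> d" using a d by (simp add: da_pow m_assoc)
    also have "\<dots> = a [^] (2 ^ Suc k * i) \<otimes> d [^] Suc k"
      using a d by (simp add: Suc m_assoc mult.assoc mult.left_commute)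
    finally show ?case .
  qed (use a d in simp)
  have mult: "e i k \<otimes> e j l = e (i + 2 ^ k * j) (k + l)" for i j k l
  proof -
    have "e i k \<otimes> e j l = a [^] i \<otimes> (d [^] k \<otimes> a [^] j) \<otimes> d [^] l"
      using a d by (simp add: e_def m_assoc)
    also have "\<dots> = (a [^] i \<otimes> a [^] (2 ^ k * j)) \<otimes> (d [^] k \<otimes> d [^] l)"
      using a d by (simp add: comm m_assoc)
    finally show ?thesis using a d by (simp add: e_def nat_pow_mult)
  qed
  have red: "e i k = e (i mod 9) (k mod 6)" for i k
  proof -
    have "x [^] n = x [^] (n mod m)" if "x \<in> carrier G" "x [^] m = \<one>" for x and n m :: nat
    proof -
      have "x [^] (m * (n div m)) = \<one>" using that by (simp add: nat_pow_pow[symmetric])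
      then show ?thesis using that nat_pow_mult[of x "m * (n div m)" "n mod m"] by simp
    qed
    from this[OF a a9] this[OF d d6] have "a [^] i = a [^] (i mod 9)" "d [^] k = d [^] (k mod 6)" .
    then show ?thesis by (simp add: e_def)
  qed
  have surj: "carrier G = (\<lambda>(i, k). e i k) ` ({..<9} \<times> {..<6})"
  proof (intro equalityI subsetI)
    fix x assume "x \<in> carrier G"
    then obtain i k where "x = e i k" using gen by blast
    then have "x = (\<lambda>(i, k). e i k) (i mod 9, k mod 6)" by (simp add: red[of i k])
    then show "x \<in> (\<lambda>(i, k). e i k) ` ({..<9} \<times> {..<6})" by (rule image_eqI) auto
  qed auto
  \<comment> \<open>The group has order 54 = 9 * 6, the number of exponent pairs, so surjectivity
    already makes the exponents unique.\<close>
  have inj: "inj_on (\<lambda>(i, k). e i k) ({..<9} \<times> {..<6})"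
    by (rule eq_card_imp_inj_on) (use surj ord in \<open>auto simp: order_def\<close>)
  have e_eq: "e i k = e j l \<longleftrightarrow> i mod 9 = j mod 9 \<and> k mod 6 = l mod 6" for i j k l
    using inj_onD[OF inj, of "(i mod 9, k mod 6)" "(j mod 9, l mod 6)"] red[of i k] red[of j l]
    by auto
  have one: "e 0 0 = \<one>" using a d by (simp add: e_def)
  \<comment> \<open>The inverse is d^(-k) a^(-i), with -1 written as 5 modulo 6 and as 8 modulo
    9.\<close>
  have inv: "inv (e i k) = e (2 ^ (5 * k) * 8 * i) (5 * k)" for i k
  proof (rule inv_equality)
    have "[2 ^ (5 * k) * 8 * i + 2 ^ (5 * k) * i = 0] (mod 9)"
      by (rule cong_sym) (simp add: cong_def algebra_simps mult_mod_right)
    then show "e (2 ^ (5 * k) * 8 * i) (5 * k) \<otimes> e i k = \<one>"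
      by (simp add: mult one[symmetric] e_eq cong_def)
  qed simp_all
  \<comment> \<open>The exponent of \<open>d\<close> becomes k + l + 5k, which is l modulo 6: the
    quotient by the powers of \<open>a\<close> is abelian.\<close>
  have conj: "\<exists>m. e i k \<otimes> e j l \<otimes> inv (e i k) = e m l" for i j k l
    by (auto simp: inv mult e_eq intro!: exI)
  \<comment> \<open>Conjugation by d^2 multiplies exponents of \<open>a\<close> by 4, which has
    order 3 modulo 9; conjugation by d^3 multiplies them by 8, that is, inverts. These are the
    factors of orders 3 and 2.\<close>
  define K where "K = range (\<lambda>(i, j). e i (2 * j))"
  define N where "N = range (\<lambda>i. e i 0)"
  define P where "P = range (\<lambda>j. e 0 (2 * j))"
  define Q where "Q = range (\<lambda>l. e 0 (3 * l))"
  have sub: "subgroup (range (\<lambda>x. e (f x) (g x))) G"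
    if "\<And>x y. \<exists>z. e (f x + 2 ^ g x * f y) (g x + g y) = e (f z) (g z)"
      "\<And>x. \<exists>z. e (2 ^ (5 * g x) * 8 * f x) (5 * g x) = e (f z) (g z)"
    for f g :: "'z \<Rightarrow> nat"
  proof (rule subgroupI)
    fix x y assume "x \<in> range (\<lambda>x. e (f x) (g x))" "y \<in> range (\<lambda>x. e (f x) (g x))"
    then obtain u v where "x = e (f u) (g u)" "y = e (f v) (g v)" by blast
    then show "inv x \<in> range (\<lambda>x. e (f x) (g x))" "x \<otimes> y \<in> range (\<lambda>x. e (f x) (g x))"
      using that(1)[of u v] that(2)[of u] by (auto simp: inv mult)
  qed auto
  have K: "subgroup K G"
    unfolding K_def case_prod_beta
  proof (rule sub)
    show "\<exists>z. e (fst x + 2 ^ (2 * snd x) * fst y) (2 * snd x + 2 * snd y) = e (fst z) (2 * snd z)"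
      for x y :: "nat \<times> nat"
      by (rule exI[of _ "(fst x + 2 ^ (2 * snd x) * fst y, snd x + snd y)"]) simp
    show "\<exists>z. e (2 ^ (5 * (2 * snd x)) * 8 * fst x) (5 * (2 * snd x)) = e (fst z) (2 * snd z)"
      for x :: "nat \<times> nat"
      by (rule exI[of _ "(2 ^ (5 * (2 * snd x)) * 8 * fst x, 5 * snd x)"]) simp
  qed
  have N: "subgroup N G"
    unfolding N_def by (rule sub[of "\<lambda>i. i" "\<lambda>_. 0"]) auto
  have P: "subgroup P G"
    unfolding P_def
  proof (rule sub)
    show "\<exists>z. e (0 + 2 ^ (2 * x) * 0) (2 * x + 2 * y) = e 0 (2 * z)" for x y :: nat
      by (rule exI[of _ "x + y"]) simp
    show "\<exists>z. e (2 ^ (5 * (2 * x)) * 8 * 0) (5 * (2 * x)) = e 0 (2 * z)" for x :: nat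
      by (rule exI[of _ "5 * x"]) simp
  qed
  have Q: "subgroup Q G"
    unfolding Q_def
  proof (rule sub)
    show "\<exists>z. e (0 + 2 ^ (3 * x) * 0) (3 * x + 3 * y) = e 0 (3 * z)" for x y :: nat
      by (rule exI[of _ "x + y"]) simp
    show "\<exists>z. e (2 ^ (5 * (3 * x)) * 8 * 0) (5 * (3 * x)) = e 0 (3 * z)" for x :: nat
      by (rule exI[of _ "5 * x"]) simp
  qed
  have K_normal: "K \<lhd> G"
    unfolding normal_inv_iff
  proof (intro conjI K ballI)
    fix x h assume "x \<in> carrier G" "h \<in> K"
    then obtain i k j l where "x = e i k" "h = e j (2 * l)" using gen[of x] by (auto simp: K_def)
    moreover obtain m where "e i k \<otimes> e j (2 * l) \<otimes> inv (e i k) = e m (2 * l)" using conj by blast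
    ultimately have "x \<otimes> h \<otimes> inv x = (\<lambda>(i, j). e i (2 * j)) (m, l)" by simp
    then show "x \<otimes> h \<otimes> inv x \<in> K" unfolding K_def by blast
  qed
  have N_normal: "N \<lhd> G"
    unfolding normal_inv_iff
  proof (intro conjI N ballI)
    fix x h assume "x \<in> carrier G" "h \<in> N"
    then obtain i k j where "x = e i k" "h = e j 0" using gen[of x] by (auto simp: N_def)
    then show "x \<otimes> h \<otimes> inv x \<in> N" using conj[of i k j 0] by (auto simp: N_def)
  qed
  have e_K: "e i (2 * j) \<in> K" for i j
    unfolding K_def by (rule range_eqI[of _ _ "(i, j)"]) simp
  have N_K: "N \<subseteq> K" using e_K[of _ 0] by (auto simp: N_def)
  have P_K: "P \<subseteq> K" using e_K by (auto simp: P_def)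
  have "\<not> Q \<lhd> G"
  proof
    assume "Q \<lhd> G"
    moreover have "e 0 3 \<in> Q" by (auto simp: Q_def intro: range_eqI[of _ _ 1])
    \<comment> \<open>The conjugate is a^2 d^3, since 1 + 8 * 8 = 65 is 2 modulo 9.\<close>
    ultimately have "e 1 0 \<otimes> e 0 3 \<otimes> inv (e 1 0) \<in> Q" by (simp add: normal_inv_iff)
    then show False by (auto simp: Q_def inv mult e_eq)
  qed
  moreover have "K \<inter> Q = {\<one>}"
  proof -
    have "e i (2 * j) = \<one>" if "e i (2 * j) = e 0 (3 * l)" for i j l
    proof -
      have "(2 * j) mod 6 = (3 * l) mod 6" "i mod 9 = 0" using that by (simp_all add: e_eq)
      then show ?thesis unfolding one[symmetric] e_eq by presburger
    qed
    moreover have "\<one> \<in> K" "\<one> \<in> Q" using K Q subgroup.one_closed by blast+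
    moreover have "\<exists>i j l. x = e i (2 * j) \<and> x = e 0 (3 * l)" if "x \<in> K \<inter> Q" for x
      using that by (auto simp: K_def Q_def)
    ultimately show ?thesis by blast
  qed
  moreover have "K <#> Q = carrier G"
  proof -
    have "\<exists>x\<in>K. \<exists>y\<in>Q. e i k = x \<otimes> y" for i k
    proof (intro bexI)
      \<comment> \<open>Modulo 6 the exponent k splits as 4k + 3k = 7k, an even part for
        \<open>K\<close> and a multiple of 3 for \<open>Q\<close>.\<close>
      have "e i (2 * (2 * k)) \<otimes> e 0 (3 * k) = e i (k + 6 * k)" by (simp add: mult)
      also have "\<dots> = e i k" unfolding e_eq by (simp only: mod_mult_self2)
      finally show "e i k = e i (2 * (2 * k)) \<otimes> e 0 (3 * k)" ..
    qed (use e_K[of i "2 * k"] in \<open>auto simp: Q_def\<close>)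
    then show ?thesis using gen K Q by (auto simp: set_mult_def dest: subgroup.mem_carrier) metis
  qed
  ultimately have 1: "inner_semidirect G K Q"
    using K_normal Q by (simp add: inner_semidirect_def)
  interpret K: group "G\<lparr>carrier := K\<rparr>" by (rule subgroup_imp_group[OF K])
  have "\<not> P \<lhd> G\<lparr>carrier := K\<rparr>"
  proof
    assume "P \<lhd> G\<lparr>carrier := K\<rparr>"
    moreover have "e 0 2 \<in> P" by (auto simp: P_def intro: range_eqI[of _ _ 1])
    moreover have "e 1 0 \<in> K" using N_K by (auto simp: N_def)
    \<comment> \<open>The conjugate is a^6 d^2, since 1 + 4 * 8 = 33 is 6 modulo 9.\<close>
    ultimately have "e 1 0 \<otimes> e 0 2 \<otimes> inv (e 1 0) \<in> P"
      by (auto simp: K.normal_inv_iff m_inv_consistent[OF K])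
    then show False by (auto simp: P_def inv mult e_eq)
  qed
  moreover have "N \<inter> P = {\<one>}"
  proof -
    have "e i 0 = \<one>" if "e i 0 = e 0 (2 * j)" for i j
      using that by (auto simp: e_eq one[symmetric])
    moreover have "\<one> \<in> N" "\<one> \<in> P" using N P subgroup.one_closed by blast+
    moreover have "\<exists>i j. x = e i 0 \<and> x = e 0 (2 * j)" if "x \<in> N \<inter> P" for x
      using that by (auto simp: N_def P_def)
    ultimately show ?thesis by blast
  qed
  moreover have "N <#> P = K"
  proof (intro equalityI subsetI)
    fix x assume "x \<in> N <#> P"
    then show "x \<in> K" using e_K by (auto simp: set_mult_def N_def P_def mult)
  next
    fix x assume "x \<in> K"
    then obtain i j where "x = e i 0 \<otimes> e 0 (2 * j)" by (auto simp: K_def mult)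
    then show "x \<in> N <#> P" unfolding set_mult_def N_def P_def by blast
  qed
  ultimately have 2: "inner_semidirect (G\<lparr>carrier := K\<rparr>) N P"
    using normal_restrict_supergroup[OF K N_normal N_K] subgroup_incl[OF P K P_K]
    by (simp add: inner_semidirect_def set_mult_def)
  have "N = range (\<lambda>i::nat. a [^] i)" using a by (simp add: N_def e_def)
  moreover have "a [^] i = a [^] j \<longleftrightarrow> [i = j] (mod 9)" for i j :: nat
    using e_eq[of i 0 j 0] a by (simp add: e_def cong_def)
  ultimately have 3: "G\<lparr>carrier := N\<rparr> \<cong> integer_mod_group 9"
    using cyclic_powers_iso_integer_mod_group[OF a, of 9] by simp
  have "P = range (\<lambda>i::nat. (d [^] (2::nat)) [^] i)" using d by (simp add: P_def e_def nat_pow_pow)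
  moreover have "(d [^] (2::nat)) [^] i = (d [^] (2::nat)) [^] j \<longleftrightarrow> [i = j] (mod 3)" for i j :: nat
  proof -
    have "(d [^] (2::nat)) [^] i = (d [^] (2::nat)) [^] j \<longleftrightarrow> (2 * i) mod 6 = (2 * j) mod 6"
      using e_eq[of 0 "2 * i" 0 "2 * j"] d by (simp add: e_def nat_pow_pow)
    then show ?thesis by (simp add: cong_def flip: mult_mod_right[of 2 _ 3, simplified])
  qed
  ultimately have 4: "G\<lparr>carrier := P\<rparr> \<cong> integer_mod_group 3"
    using cyclic_powers_iso_integer_mod_group[of "d [^] (2::nat)" 3] d by simp
  have "Q = range (\<lambda>i::nat. (d [^] (3::nat)) [^] i)" using d by (simp add: Q_def e_def nat_pow_pow)
  moreover have "(d [^] (3::nat)) [^] i = (d [^] (3::nat)) [^] j \<longleftrightarrow> [i = j] (mod 2)" for i j :: nat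
  proof -
    have "(d [^] (3::nat)) [^] i = (d [^] (3::nat)) [^] j \<longleftrightarrow> (3 * i) mod 6 = (3 * j) mod 6"
      using e_eq[of 0 "3 * i" 0 "3 * j"] d by (simp add: e_def nat_pow_pow)
    then show ?thesis by (simp add: cong_def flip: mult_mod_right[of 3 _ 2, simplified])
  qed
  ultimately have 5: "G\<lparr>carrier := Q\<rparr> \<cong> integer_mod_group 2"
    using cyclic_powers_iso_integer_mod_group[of "d [^] (3::nat)" 2] d by simp
  show ?thesis unfolding type_C9_C3_C2_def using 1 2 3 4 5 by blast
qed

section \<open>Cayley graphs of elementary abelian 2-groups\<close>

lemma graph_isomorphic_sym:
  assumes "graph_isomorphic \<Gamma> \<Delta>"
  shows "graph_isomorphic \<Delta> \<Gamma>"
proof -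
  obtain f where f: "bij_betw f (verts \<Gamma>) (verts \<Delta>)"
    and e: "\<And>u v. u \<in> verts \<Gamma> \<Longrightarrow> v \<in> verts \<Gamma> \<Longrightarrow> {u, v} \<in> edges \<Gamma> \<longleftrightarrow> {f u, f v} \<in> edges \<Delta>"
    using assms by (auto simp: graph_isomorphic_def graph_isomorphism_def)
  let ?g = "inv_into (verts \<Gamma>) f"
  have "?g x \<in> verts \<Gamma>" "f (?g x) = x" if "x \<in> verts \<Delta>" for x
    using f that by (auto simp: bij_betw_def inv_into_into f_inv_into_f)
  then have "graph_isomorphism \<Delta> \<Gamma> ?g"
    using bij_betw_inv_into[OF f] by (simp add: graph_isomorphism_def e)
  then show ?thesis by (auto simp: graph_isomorphic_def)
qed

lemma graph_isomorphic_trans: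
  assumes "graph_isomorphic \<Gamma> \<Delta>" and "graph_isomorphic \<Delta> \<Theta>"
  shows "graph_isomorphic \<Gamma> \<Theta>"
proof -
  obtain f g where f: "graph_isomorphism \<Gamma> \<Delta> f" and g: "graph_isomorphism \<Delta> \<Theta> g"
    using assms by (auto simp: graph_isomorphic_def)
  have "f u \<in> verts \<Delta>" if "u \<in> verts \<Gamma>" for u
    using f that by (auto simp: graph_isomorphism_def bij_betw_def)
  then have "graph_isomorphism \<Gamma> \<Theta> (g \<circ> f)"
    using f g by (auto simp: graph_isomorphism_def intro: bij_betw_trans)
  then show ?thesis by (auto simp: graph_isomorphic_def)
qed

lemma graph_isomorphism_graph_of:
  assumes f: "bij_betw f V W" and adj: "\<And>u v. u \<in> V \<Longrightarrow> v \<in> V \<Longrightarrow> u \<noteq> v \<Longrightarrow> r u v \<longleftrightarrow> r' (f u) (f v)"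
    and sym: "\<And>u v. r u v \<Longrightarrow> r v u" "\<And>u v. r' u v \<Longrightarrow> r' v u"
  shows "graph_isomorphism (graph_of V r) (graph_of W r') f"
proof -
  have *: "{u, v} \<in> edges (graph_of V r) \<longleftrightarrow> u \<in> V \<and> v \<in> V \<and> u \<noteq> v \<and> r u v"
    if "\<And>u v. r u v \<Longrightarrow> r v u" for u v :: 'z and V r
    using that by (auto simp: graph_of_def doubleton_eq_iff)
  have "f u = f v \<longleftrightarrow> u = v" "f u \<in> W" if "u \<in> V" "v \<in> V" for u v
    using f that by (auto simp: bij_betw_def inj_on_eq_iff)
  then show ?thesis
    using f adj by (auto simp: graph_isomorphism_def *[OF sym(1)] *[OF sym(2)])
      (simp_all add: graph_of_def)
qed

text \<open>\<open>\<Gamma>\<close> is a copy, along the injection \<open>\<psi>\<close>, of the Cayley graph of an elementary abelian 2-group with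
  connection set \<open>S\<close>.\<close>

locale cayley_copy =
  fixes S :: "'v::{ab_group_add,finite} set" and \<psi> :: "'v \<Rightarrow> 'b" and \<Gamma> :: "'b graph"
  assumes add_self: "x + x = (0::'v)"
    and zero_notin: "0 \<notin> S"
    and generates: "\<And>P v. P 0 \<Longrightarrow> (\<And>x s. P x \<Longrightarrow> s \<in> S \<Longrightarrow> P (x + s)) \<Longrightarrow> P (v::'v)"
    and sidon: "\<And>s t s' t'. \<lbrakk>s \<in> S; t \<in> S; s' \<in> S; t' \<in> S; s + t = s' + t'; s \<noteq> t; s + t \<notin> S\<rbrakk>
      \<Longrightarrow> s' = s \<or> s' = t"
    and triangle: "\<And>s t u. \<lbrakk>s \<in> S; t \<in> S; u \<in> S; s + t \<in> S; s + u \<in> S; t + u \<in> S\<rbrakk> \<Longrightarrow> u = s + t"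
    and inj: "inj \<psi>"
    and graph_eq: "\<Gamma> = (range \<psi>, {{\<psi> u, \<psi> v} | u v. u + v \<in> S})"
begin

lemma add_self_left: "x + (x + y) = (y::'v)"
  by (metis add_self add.assoc add.left_neutral)

lemmas char2 = add.assoc add.commute add.left_commute add_self add_self_left

lemma add_eq_0_iff_eq: "x + y = 0 \<longleftrightarrow> x = (y::'v)"
  by (metis add_self add_self_left add.right_neutral)

lemma adjacent: "{\<psi> u, \<psi> v} \<in> edges \<Gamma> \<longleftrightarrow> u + v \<in> S"
  using inj by (auto simp: graph_eq doubleton_eq_iff inj_eq add.commute)

lemma verts_eq: "verts \<Gamma> = range \<psi>"
  by (simp add: graph_eq)

section \<open>Adjacency preserving permutations are affine\<close>

definition adj_preserving :: "('v \<Rightarrow> 'v) \<Rightarrow> bool" where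
  "adj_preserving f \<longleftrightarrow> bij f \<and> (\<forall>u v. f u + f v \<in> S \<longleftrightarrow> u + v \<in> S)"

text \<open>The two vertices \<open>s\<close> and \<open>t\<close> have exactly two common neighbours, \<open>0\<close> and \<open>s + t\<close>, unless the
  three vertices \<open>0\<close>, \<open>s\<close>, \<open>t\<close> lie in a common clique.\<close>

lemma adj_preserving_add_neighbours:
  assumes f: "adj_preserving f" "f 0 = 0" and s: "s \<in> S" and t: "t \<in> S"
  shows "f (s + t) = f s + f t"
proof -
  have adj: "f u + f v \<in> S \<longleftrightarrow> u + v \<in> S" and eq: "f u = f v \<longleftrightarrow> u = v" for u v
    using f by (auto simp: adj_preserving_def bij_def inj_eq)
  have fS: "f u \<in> S \<longleftrightarrow> u \<in> S" for u using adj[of u 0] f(2) by simp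
  have 1: "f (s + t) + f s \<in> S" "f (s + t) + f t \<in> S"
    using s t by (simp_all add: adj char2)
  show ?thesis
  proof (cases "s = t \<or> s + t \<in> S")
    case True
    then consider "s = t" | "s + t \<in> S" by blast
    then show ?thesis
    proof cases
      case 2
      then show ?thesis using triangle[of "f s" "f t" "f (s + t)"] 1 s t
        by (simp add: fS adj add.commute)
    qed (simp add: add_self f)
  next
    case False
    have "f s + f t = (f (s + t) + f t) + (f (s + t) + f s)" by (simp add: char2)
    then have "f (s + t) + f t = f s \<or> f (s + t) + f t = f t"
      using sidon[of "f s" "f t" "f (s + t) + f t" "f (s + t) + f s"] 1 s t False
      by (simp add: fS adj eq)
    \<comment> \<open>This excludes the second alternative: f(s + t) + f(t) = f(t) would say that
      the common neighbour s + t is sent to 0.\<close>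
    moreover have "f (s + t) \<noteq> 0"
      using eq[of "s + t" 0] False by (simp add: f add_eq_0_iff_eq)
    ultimately show ?thesis by (metis add_self_left add.commute add_eq_0_iff_eq)
  qed
qed

text \<open>The difference f(s + v) + f(v) does not change when v moves along an edge, and since
  \<open>S\<close> generates the group it equals its value f(s) at v = 0.\<close>

lemma adj_preserving_additive:
  assumes f: "adj_preserving f" "f 0 = 0"
  shows "f (x + y) = f x + f y"
proof -
  have *: "f (s + v) + f v = f s" if s: "s \<in> S" for s v
  proof (induction v rule: generates)
    case (2 v t)
    \<comment> \<open>\<open>g\<close> is \<open>f\<close> with the vertex v moved to the origin on
      both sides; it again preserves adjacency and fixes 0, so the result on neighbours of 0 applies
      to it.\<close>
    define g where "g = (\<lambda>x. f (x + v) + f v)"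
    have "g = (\<lambda>x. f v + x) \<circ> f \<circ> (\<lambda>x. v + x)" by (simp add: g_def fun_eq_iff add.commute)
    then have "bij g"
      using f(1) by (simp add: adj_preserving_def bij_comp bij_plus_right)
    moreover have "g u + g w = f (u + v) + f (w + v)" for u w
      by (simp add: g_def char2)
    ultimately have "adj_preserving g"
      using f(1) by (simp add: adj_preserving_def char2)
    then have "g (s + t) = g s + g t"
      by (rule adj_preserving_add_neighbours) (use s 2 in \<open>simp_all add: g_def add_self\<close>)
    moreover have "f (s + (v + t)) + f (v + t) = g (s + t) + g t"
      by (simp add: g_def char2)
    ultimately show ?case using 2 by (simp add: char2 g_def)
  qed (simp add: f)
  show ?thesis
  proof (induction y rule: generates)
    case (2 y s)
    have "f (x + (y + s)) = f s + f (x + y)" "f (y + s) = f s + f y"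
      using *[of s "x + y"] *[of s y] 2 by (metis add_self_left add.commute add.left_commute)+
    then show ?case using 2 by (simp add: char2)
  qed (simp add: f)
qed

text \<open>Over the prime field with two elements additivity is linearity.\<close>

definition linear_stab :: "('v \<Rightarrow> 'v) set" where
  "linear_stab = {A. (\<forall>x y. A (x + y) = A x + A y) \<and> bij A \<and> (\<forall>x. A x \<in> S \<longleftrightarrow> x \<in> S)}"

lemma linear_stabD:
  assumes "A \<in> linear_stab"
  shows "A (x + y) = A x + A y" "bij A" "A x \<in> S \<longleftrightarrow> x \<in> S" "A 0 = 0"
proof -
  show *: "A (x + y) = A x + A y" for x y using assms by (simp add: linear_stab_def)
  show "A 0 = 0" using *[of 0 0] by (simp add: add_self)
qed (use assms in \<open>auto simp: linear_stab_def\<close>)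

definition affine_map :: "('v \<Rightarrow> 'v) \<Rightarrow> 'v \<Rightarrow> 'v \<Rightarrow> 'v" where
  "affine_map A v = (\<lambda>x. A x + v)"

lemma bij_affine_map: "A \<in> linear_stab \<Longrightarrow> bij (affine_map A v)"
  using bij_comp[of A "\<lambda>x. x + v"] linear_stabD(2)[of A] bij_plus_right[of v]
  by (simp add: affine_map_def comp_def add.commute)

lemma adj_preserving_iff_affine:
  "adj_preserving f \<longleftrightarrow> (\<exists>A\<in>linear_stab. \<exists>v. f = affine_map A v)"
proof
  assume f: "adj_preserving f"
  define A where "A = (\<lambda>x. f x + f 0)"
  have "bij A"
    using bij_comp[of f "\<lambda>x. x + f 0"] f bij_plus_right[of "f 0"]
    by (simp add: A_def comp_def add.commute adj_preserving_def)
  then have A: "adj_preserving A"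
    using f by (simp add: adj_preserving_def A_def char2)
  have A0: "A 0 = 0" by (simp add: A_def add_self)
  have "A x \<in> S \<longleftrightarrow> x \<in> S" for x
    using A A0 unfolding adj_preserving_def by (metis add.right_neutral)
  then have "A \<in> linear_stab"
    using adj_preserving_additive[OF A A0] \<open>bij A\<close> by (simp add: linear_stab_def)
  moreover have "f = affine_map A (f 0)" by (simp add: fun_eq_iff affine_map_def A_def char2)
  ultimately show "\<exists>A\<in>linear_stab. \<exists>v. f = affine_map A v" by blast
next
  assume "\<exists>A\<in>linear_stab. \<exists>v. f = affine_map A v"
  then obtain A v where A: "A \<in> linear_stab" and f: "f = affine_map A v" by blast
  have "f x + f y = A (x + y)" for x y
    using linear_stabD(1)[OF A] by (simp add: f affine_map_def char2)
  then show "adj_preserving f"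
    using bij_affine_map[OF A] f linear_stabD(3)[OF A] by (simp add: adj_preserving_def)
qed

lemma affine_map_inject:
  assumes "A \<in> linear_stab" "B \<in> linear_stab"
  shows "affine_map A v = affine_map B w \<longleftrightarrow> A = B \<and> v = w"
proof
  assume "affine_map A v = affine_map B w"
  then have *: "A x + v = B x + w" for x by (simp add: affine_map_def fun_eq_iff)
  have "v = w" using *[of 0] assms by (simp add: linear_stabD(4))
  then show "A = B \<and> v = w" using * by auto
qed simp

lemma id_linear_stab: "id \<in> linear_stab"
  by (simp add: linear_stab_def)

lemma comp_linear_stab: "A \<in> linear_stab \<Longrightarrow> B \<in> linear_stab \<Longrightarrow> A \<circ> B \<in> linear_stab"
  by (simp add: linear_stab_def bij_comp)

lemma funpow_linear_stab: "A \<in> linear_stab \<Longrightarrow> A ^^ n \<in> linear_stab"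
  by (induction n) (simp_all add: id_linear_stab comp_linear_stab flip: id_def)

lemma affine_map_comp:
  assumes "A \<in> linear_stab"
  shows "affine_map A v \<circ> affine_map B w = affine_map (A \<circ> B) (A w + v)"
  using linear_stabD(1)[OF assms] by (simp add: fun_eq_iff affine_map_def add.assoc)

text \<open>For an explicitly given map of finite order it is enough to check that points go to
  points: the power A^(n-1) is the inverse and preserves \<open>S\<close> as well.\<close>

lemma linear_stabI:
  assumes add: "\<And>x y. A (x + y) = A x + A y" and fin: "A ^^ n = id" "n > 0"
    and S: "\<And>s. s \<in> S \<Longrightarrow> A s \<in> S"
  shows "A \<in> linear_stab"
proof -
  obtain m where n: "n = Suc m" using fin(2) gr0_conv_Suc by blast
  then have inv: "(A ^^ m) (A x) = x" "A ((A ^^ m) x) = x" for x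
    using fin(1) by (auto simp: fun_eq_iff funpow_swap1)
  then have "bij A" by (intro o_bij[of "A ^^ m"]) (simp_all add: fun_eq_iff)
  moreover have "x \<in> S" if "A x \<in> S" for x
  proof -
    have "(A ^^ k) (A x) \<in> S" for k by (induction k) (simp_all add: that S)
    from this[of m] show ?thesis by (simp add: inv)
  qed
  ultimately have "bij A" "A x \<in> S \<longleftrightarrow> x \<in> S" for x using S by blast+
  then show ?thesis by (simp add: linear_stab_def add)
qed

lemma inv_linear_stab:
  assumes A: "A \<in> linear_stab"
  shows "inv_into UNIV A \<in> linear_stab"
proof -
  note bij = linear_stabD(2)[OF A]
  have inv: "A (inv_into UNIV A x) = x" for x using bij by (simp add: bij_is_surj surj_f_inv_f)
  have "inv_into UNIV A (x + y) = inv_into UNIV A x + inv_into UNIV A y" for x y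
    using linear_stabD(1)[OF A] inv by (intro inv_f_eq bij_is_inj bij) simp
  moreover have "inv_into UNIV A x \<in> S \<longleftrightarrow> x \<in> S" for x
    using linear_stabD(3)[OF A, of "inv_into UNIV A x"] inv by simp
  ultimately show ?thesis using bij_imp_bij_inv[OF bij] by (simp add: linear_stab_def)
qed

lemma orbit_linear_stab:
  assumes "s \<in> {A p | A. A \<in> linear_stab}"
  shows "{A s | A. A \<in> linear_stab} = {A p | A. A \<in> linear_stab}"
proof -
  obtain B where B: "B \<in> linear_stab" and s: "s = B p" using assms by blast
  have p: "p = inv_into UNIV B s" using linear_stabD(2)[OF B] by (simp add: s bij_is_inj)
  show ?thesis
  proof (intro equalityI subsetI)
    fix t assume "t \<in> {A s | A. A \<in> linear_stab}"
    then obtain A where "A \<in> linear_stab" "t = (A \<circ> B) p" using s by auto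
    then show "t \<in> {A p | A. A \<in> linear_stab}" using comp_linear_stab[OF _ B] by blast
  next
    fix t assume "t \<in> {A p | A. A \<in> linear_stab}"
    then obtain A where "A \<in> linear_stab" "t = (A \<circ> inv_into UNIV B) s" using p by auto
    then show "t \<in> {A s | A. A \<in> linear_stab}" using comp_linear_stab[OF _ inv_linear_stab[OF B]] by blast
  qed
qed

subsection \<open>The automorphism group\<close>

text \<open>The members of \<open>BijGroup\<close> are extensional functions, so the lift is
  restricted to the vertex set; this makes it the unique representative there.\<close>

definition lift :: "('v \<Rightarrow> 'v) \<Rightarrow> 'b \<Rightarrow> 'b" where
  "lift f = (\<lambda>X\<in>range \<psi>. \<psi> (f (inv_into UNIV \<psi> X)))"

abbreviation Aut :: "('b \<Rightarrow> 'b) monoid" where "Aut \<equiv> graph_aut \<Gamma>"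

lemma lift_apply [simp]: "lift f (\<psi> x) = \<psi> (f x)"
  using inj by (simp add: lift_def)

lemma lift_inject [simp]: "lift f = lift g \<longleftrightarrow> f = g"
  by (metis ext lift_apply inj injD)

lemma lift_Bij: "bij f \<Longrightarrow> lift f \<in> Bij (range \<psi>)"
proof -
  assume "bij f"
  moreover have "bij_betw \<psi> UNIV (range \<psi>)" using inj by (simp add: bij_betw_def)
  ultimately have "bij_betw (\<psi> \<circ> f \<circ> inv_into UNIV \<psi>) (range \<psi>) (range \<psi>)"
    by (blast intro: bij_betw_trans bij_betw_inv_into)
  then have "bij_betw (lift f) (range \<psi>) (range \<psi>)"
    by (rule bij_betw_cong[THEN iffD1, rotated]) (simp add: lift_def)
  then show ?thesis by (simp add: Bij_def lift_def)
qed

lemma carrier_Aut_eq_lift: "carrier Aut = lift ` {f. adj_preserving f}"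
proof (intro equalityI subsetI)
  fix g assume "g \<in> carrier Aut"
  then have g: "g \<in> Bij (range \<psi>)" "graph_isomorphism \<Gamma> \<Gamma> g"
    by (simp_all add: graph_aut_def verts_eq)
  define f where "f = inv_into UNIV \<psi> \<circ> g \<circ> \<psi>"
  have bb: "bij_betw \<psi> UNIV (range \<psi>)" using inj by (simp add: bij_betw_def)
  have "bij f" unfolding f_def
    using bij_betw_trans[OF bij_betw_trans[OF bb, of g] bij_betw_inv_into[OF bb]] g
    by (simp add: Bij_def comp_assoc)
  have \<psi>f: "\<psi> (f x) = g (\<psi> x)" for x
    using g(1) unfolding f_def comp_def by (intro f_inv_into_f) (auto simp: Bij_def bij_betw_def)
  have "f u + f v \<in> S \<longleftrightarrow> u + v \<in> S" for u v
    using g(2) by (simp flip: adjacent add: \<psi>f graph_isomorphism_def verts_eq)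
  moreover have "g = lift f"
    using g(1) by (auto simp: lift_def \<psi>f Bij_def extensional_def f_inv_into_f)
  ultimately show "g \<in> lift ` {f. adj_preserving f}"
    using \<open>bij f\<close> by (simp add: adj_preserving_def)
next
  fix g assume "g \<in> lift ` {f. adj_preserving f}"
  then obtain f where f: "bij f" "\<And>u v. f u + f v \<in> S \<longleftrightarrow> u + v \<in> S" and g: "g = lift f"
    by (auto simp: adj_preserving_def)
  then show "g \<in> carrier Aut"
    using lift_Bij[OF f(1)]
    by (auto simp: graph_aut_def graph_isomorphism_def verts_eq adjacent Bij_def)
qed

lemma carrier_Aut: "carrier Aut = {lift (affine_map A v) | A v. A \<in> linear_stab}"
  unfolding carrier_Aut_eq_lift adj_preserving_iff_affine by auto

lemma affine_in_Aut: "A \<in> linear_stab \<Longrightarrow> lift (affine_map A v) \<in> carrier Aut"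
  by (auto simp: carrier_Aut)

lemma lift_mult: "bij f \<Longrightarrow> bij g \<Longrightarrow> lift f \<otimes>\<^bsub>Aut\<^esub> lift g = lift (f \<circ> g)"
  using lift_Bij[of f] lift_Bij[of g]
  by (auto simp: graph_aut_def BijGroup_def verts_eq compose_def lift_def inj)

lemma lift_one: "\<one>\<^bsub>Aut\<^esub> = lift id"
  by (auto simp: graph_aut_def BijGroup_def verts_eq lift_def f_inv_into_f)

lemma Aut_subgroup: "subgroup (carrier Aut) (BijGroup (verts \<Gamma>))"
proof -
  interpret B: group "BijGroup (verts \<Gamma>)" by (rule group_BijGroup)
  have mult: "x \<otimes>\<^bsub>BijGroup (verts \<Gamma>)\<^esub> y = x \<otimes>\<^bsub>Aut\<^esub> y" for x y
    by (simp add: graph_aut_def)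
  have sub: "carrier Aut \<subseteq> carrier (BijGroup (verts \<Gamma>))" by (auto simp: graph_aut_def BijGroup_def)
  have clos: "lift f \<otimes>\<^bsub>Aut\<^esub> lift g \<in> carrier Aut" if "adj_preserving f" "adj_preserving g" for f g
    using that bij_comp[of g f] by (auto simp: lift_mult carrier_Aut_eq_lift adj_preserving_def)
  show ?thesis
  proof (rule B.subgroupI)
    fix x assume "x \<in> carrier Aut"
    then obtain f where f: "adj_preserving f" and x: "x = lift f" by (auto simp: carrier_Aut_eq_lift)
    have "bij f" using f by (simp add: adj_preserving_def)
    have inv: "adj_preserving (inv_into UNIV f)"
      using f bij_imp_bij_inv[of f] by (auto simp: adj_preserving_def) (metis bij_inv_eq_iff)+
    then have "lift (inv_into UNIV f) \<otimes>\<^bsub>BijGroup (verts \<Gamma>)\<^esub> lift f = \<one>\<^bsub>BijGroup (verts \<Gamma>)\<^esub>"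
      using \<open>bij f\<close> lift_one
      by (simp add: mult lift_mult adj_preserving_def bij_is_inj) (simp add: graph_aut_def)
    moreover have "lift (inv_into UNIV f) \<in> carrier Aut" using inv by (auto simp: carrier_Aut_eq_lift)
    ultimately show "inv\<^bsub>BijGroup (verts \<Gamma>)\<^esub> x \<in> carrier Aut"
      using B.inv_equality[of "lift (inv_into UNIV f)" x] sub \<open>x \<in> carrier Aut\<close> x
      by (metis subsetD)
  next
    fix x y assume "x \<in> carrier Aut" "y \<in> carrier Aut"
    then show "x \<otimes>\<^bsub>BijGroup (verts \<Gamma>)\<^esub> y \<in> carrier Aut"
      using clos by (auto simp: mult carrier_Aut_eq_lift)
  qed (use sub id_linear_stab in \<open>auto simp: carrier_Aut\<close>)
qed

lemma group_Aut: "group Aut"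
proof -
  have "Aut = BijGroup (verts \<Gamma>)\<lparr>carrier := carrier Aut\<rparr>" by (simp add: graph_aut_def)
  then show ?thesis using group.subgroup_imp_group[OF group_BijGroup Aut_subgroup] by simp
qed

lemma affine_mult:
  assumes "A \<in> linear_stab" "B \<in> linear_stab"
  shows "lift (affine_map A v) \<otimes>\<^bsub>Aut\<^esub> lift (affine_map B w) = lift (affine_map (A \<circ> B) (A w + v))"
  using assms by (simp add: lift_mult bij_affine_map affine_map_comp)

lemma lift_pow: "bij f \<Longrightarrow> lift f [^]\<^bsub>Aut\<^esub> (n::nat) = lift (f ^^ n)"
proof (induction n)
  case 0 then show ?case by (simp add: lift_one id_def)
next
  case (Suc n)
  then show ?case
    by (simp add: lift_mult bij_fn funpow_Suc_right comp_def del: funpow.simps)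
qed

lemma order_Aut: "order Aut = card linear_stab * CARD('v)"
proof -
  have "bij_betw (\<lambda>(A, v). lift (affine_map A v)) (linear_stab \<times> UNIV) (carrier Aut)"
    by (auto simp: bij_betw_def inj_on_def affine_map_inject carrier_Aut)
  then show ?thesis
    using bij_betw_same_card by (fastforce simp: order_def card_cartesian_product)
qed

lemma transitive_Aut: "transitive_action Aut (verts \<Gamma>) (\<lambda>g. g)"
proof (intro transitive_action.intro group_action.intro transitive_action_axioms.intro)
  interpret group Aut by (rule group_Aut)
  show "group_hom Aut (BijGroup (verts \<Gamma>)) (\<lambda>g. g)"
    using Aut_subgroup[THEN subgroup.subset] group_BijGroup
    by (intro group_hom.intro group_hom_axioms.intro group_Aut)
      (auto simp: hom_def, auto simp: graph_aut_def)
next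
  fix x y assume "x \<in> verts \<Gamma>" "y \<in> verts \<Gamma>"
  then obtain u v where uv: "x = \<psi> u" "y = \<psi> v" by (auto simp: verts_eq)
  then have "lift (affine_map id (u + v)) x = y" by (simp add: affine_map_def char2)
  then show "\<exists>g\<in>carrier Aut. g x = y" using affine_in_Aut[OF id_linear_stab] by blast
qed

definition edges_with_difference :: "'v set \<Rightarrow> 'b set set" where
  "edges_with_difference T = {{\<psi> u, \<psi> v} | u v. u + v \<in> T}"

text \<open>An affine map acts on the difference of the two ends through its linear part only, while
  the translations realise every edge with a given difference.\<close>

lemma orbit_edge:
  assumes T: "\<And>s. s \<in> T \<Longrightarrow> {A s | A. A \<in> linear_stab} = T" and uv: "u + v \<in> T"
  shows "orbit Aut (\<lambda>g e. g ` e) {\<psi> u, \<psi> v} = edges_with_difference T"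
proof (intro equalityI subsetI)
  fix e assume "e \<in> orbit Aut (\<lambda>g e. g ` e) {\<psi> u, \<psi> v}"
  then obtain A w where A: "A \<in> linear_stab" and e: "e = {\<psi> (A u + w), \<psi> (A v + w)}"
    by (auto simp: orbit_def carrier_Aut affine_map_def)
  have "(A u + w) + (A v + w) = A (u + v)" by (simp add: linear_stabD(1)[OF A] char2)
  also have "\<dots> \<in> T" using T[OF uv] A by blast
  finally show "e \<in> edges_with_difference T" using e by (auto simp: edges_with_difference_def)
next
  fix e assume "e \<in> edges_with_difference T"
  then obtain u' v' where e: "e = {\<psi> u', \<psi> v'}" and "u' + v' \<in> T"
    by (auto simp: edges_with_difference_def)
  then have "u' + v' \<in> {A (u + v) | A. A \<in> linear_stab}" unfolding T[OF uv] by simp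
  then obtain A where A: "A \<in> linear_stab" and Auv: "A (u + v) = u' + v'" by auto
  \<comment> \<open>The translation part u' + A u is the one that takes u to u'; the choice of A
    then forces v to go to v'.\<close>
  have "A v + (u' + A u) = u' + A (u + v)"
    by (simp add: linear_stabD(1)[OF A] add.commute add.left_commute)
  then have "A v + (u' + A u) = v'" by (simp add: Auv add_self_left)
  then have "e = lift (affine_map A (u' + A u)) ` {\<psi> u, \<psi> v}"
    by (simp add: e affine_map_def char2)
  then show "e \<in> orbit Aut (\<lambda>g e. g ` e) {\<psi> u, \<psi> v}"
    using affine_in_Aut[OF A] unfolding orbit_def by blast
qed

lemma orbits_edges:
  assumes T1: "\<And>s. s \<in> T1 \<Longrightarrow> {A s | A. A \<in> linear_stab} = T1"
    and T2: "\<And>s. s \<in> T2 \<Longrightarrow> {A s | A. A \<in> linear_stab} = T2"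
    and S: "S = T1 \<union> T2" and ne: "T1 \<noteq> {}" "T2 \<noteq> {}"
  shows "orbits Aut (edges \<Gamma>) (\<lambda>g e. g ` e) = {edges_with_difference T1, edges_with_difference T2}"
proof (intro equalityI subsetI)
  fix X assume "X \<in> orbits Aut (edges \<Gamma>) (\<lambda>g e. g ` e)"
  then obtain u v where "X = orbit Aut (\<lambda>g e. g ` e) {\<psi> u, \<psi> v}" "u + v \<in> S"
    by (auto simp: orbits_def graph_eq)
  then show "X \<in> {edges_with_difference T1, edges_with_difference T2}"
    using orbit_edge[OF T1] orbit_edge[OF T2] S by blast
next
  have *: "edges_with_difference T \<in> orbits Aut (edges \<Gamma>) (\<lambda>g e. g ` e)"
    if T: "\<And>s. s \<in> T \<Longrightarrow> {A s | A. A \<in> linear_stab} = T" and ne: "T \<noteq> {}" and TS: "T \<subseteq> S" for T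
  proof -
    obtain s where "s \<in> T" "s \<in> S" using ne TS by blast
    then have "edges_with_difference T = orbit Aut (\<lambda>g e. g ` e) {\<psi> s, \<psi> 0}"
      using orbit_edge[OF T, of s 0] by simp
    moreover have "{\<psi> s, \<psi> 0} \<in> edges \<Gamma>" using \<open>s \<in> S\<close> by (simp add: adjacent)
    ultimately show ?thesis by (auto simp: orbits_def)
  qed
  fix X assume "X \<in> {edges_with_difference T1, edges_with_difference T2}"
  then show "X \<in> orbits Aut (edges \<Gamma>) (\<lambda>g e. g ` e)"
    using *[OF T1 ne(1)] *[OF T2 ne(2)] S by blast
qed

text \<open>Double counting of the ordered pairs (u, u + s) with s in \<open>T\<close>. Because 0 is
  not in \<open>T\<close>, each edge comes from exactly two of them.\<close>

lemma card_edges_with_difference: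
  assumes "0 \<notin> T"
  shows "2 * card (edges_with_difference T) = CARD('v) * card T"
proof -
  let ?pairs = "\<lambda>e. {(u, v). e = {\<psi> u, \<psi> v}}" and ?C = "edges_with_difference T"
  have fin: "finite ?C"
    by (rule finite_subset[of _ "(\<lambda>(u, v). {\<psi> u, \<psi> v}) ` UNIV"])
      (auto simp: edges_with_difference_def)
  have card2: "card (?pairs e) = 2" if "e \<in> ?C" for e
  proof -
    obtain u v where e: "e = {\<psi> u, \<psi> v}" and "u + v \<in> T"
      using \<open>e \<in> ?C\<close> by (auto simp: edges_with_difference_def)
    then have "u \<noteq> v" using assms add_self by auto
    moreover have "?pairs e = {(u, v), (v, u)}"
      using inj by (auto simp: e doubleton_eq_iff inj_eq)
    ultimately show ?thesis by simp
  qed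
  have "bij_betw (\<lambda>(u, s). (u, u + s)) (UNIV \<times> T) {(u, v). u + v \<in> T}"
    by (rule bij_betw_byWitness[where f' = "\<lambda>(u, v). (u, u + v)"]) (auto simp: char2)
  then have pairs: "card ((UNIV :: 'v set) \<times> T) = card {(u, v). u + v \<in> T}" by (rule bij_betw_same_card)
  have "CARD('v) * card T = card ((UNIV :: 'v set) \<times> T)" by (simp add: card_cartesian_product)
  also note pairs
  also have "{(u, v). u + v \<in> T} = (\<Union>e\<in>?C. ?pairs e)"
    using inj by (auto simp: edges_with_difference_def doubleton_eq_iff inj_eq add.commute)
  also have "card \<dots> = (\<Sum>e\<in>?C. card (?pairs e))"
    by (rule card_UN_disjoint) (use fin in auto)
  also have "\<dots> = 2 * card ?C" using card2 by simp
  finally show ?thesis by simp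
qed

text \<open>This is A conjugated by the translation by u, as A(x + u) + u = A x + (u + A u): the
  automorphism with linear part A that fixes \<open>\<psi> u\<close>.\<close>

definition conj_translation :: "'v \<Rightarrow> ('v \<Rightarrow> 'v) \<Rightarrow> 'b \<Rightarrow> 'b" where
  "conj_translation u A = lift (affine_map A (u + A u))"

lemma conj_translation_mult:
  assumes "A \<in> linear_stab" "B \<in> linear_stab"
  shows "conj_translation u A \<otimes>\<^bsub>Aut\<^esub> conj_translation u B = conj_translation u (A \<circ> B)"
  using assms linear_stabD(1)[OF assms(1)] by (simp add: conj_translation_def affine_mult char2)

lemma conj_translation_inject:
  "A \<in> linear_stab \<Longrightarrow> B \<in> linear_stab \<Longrightarrow> conj_translation u A = conj_translation u B \<longleftrightarrow> A = B"
  by (auto simp: conj_translation_def affine_map_inject)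

lemma conj_translation_id: "conj_translation u id = \<one>\<^bsub>Aut\<^esub>"
  by (simp add: conj_translation_def lift_one affine_map_def add_self id_def)

lemma conj_translation_pow:
  "A \<in> linear_stab \<Longrightarrow> conj_translation u A [^]\<^bsub>Aut\<^esub> (n::nat) = conj_translation u (A ^^ n)"
proof (induction n)
  case 0 then show ?case using conj_translation_id by (simp add: id_def)
next
  case (Suc n)
  then show ?case
    by (simp add: conj_translation_mult funpow_linear_stab funpow_Suc_right comp_def del: funpow.simps)
qed

lemma stabilizer_Aut: "stabilizer Aut (\<lambda>g. g) (\<psi> u) = conj_translation u ` linear_stab"
proof (intro equalityI subsetI)
  fix g assume "g \<in> stabilizer Aut (\<lambda>g. g) (\<psi> u)"
  then obtain A v where A: "A \<in> linear_stab" "g = lift (affine_map A v)" and "\<psi> (A u + v) = \<psi> u"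
    by (auto simp: stabilizer_def carrier_Aut affine_map_def)
  then have "A u + v = u" using inj by (simp add: inj_eq)
  then have "v = u + A u" by (metis add_self_left add.commute)
  then show "g \<in> conj_translation u ` linear_stab" using A by (simp add: conj_translation_def)
next
  fix g assume "g \<in> conj_translation u ` linear_stab"
  then show "g \<in> stabilizer Aut (\<lambda>g. g) (\<psi> u)"
    by (auto simp: stabilizer_def conj_translation_def affine_in_Aut)
      (simp add: affine_map_def char2)
qed

text \<open>\<open>conj_translation u\<close> is an injective homomorphism from the linear maps onto
  the stabilizer of \<open>\<psi> u\<close>, so the relations between \<open>a\<close> and
  \<open>d\<close> carry over to every vertex.\<close>

lemma type_stabilizer:
  assumes ad: "a \<in> linear_stab" "d \<in> linear_stab"
    and rel: "a ^^ 9 = id" "d ^^ 6 = id" "d \<circ> a = a ^^ 2 \<circ> d"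
    and gen: "\<And>A. A \<in> linear_stab \<Longrightarrow> \<exists>i k. A = a ^^ i \<circ> d ^^ k"
    and card: "card linear_stab = 54" and x: "x \<in> verts \<Gamma>"
  shows "type_C9_C3_C2 (Aut\<lparr>carrier := stabilizer Aut (\<lambda>g. g) x\<rparr>)"
proof -
  obtain u where u: "x = \<psi> u" using x by (auto simp: verts_eq)
  let ?St = "Aut\<lparr>carrier := stabilizer Aut (\<lambda>g. g) x\<rparr>" and ?c = "conj_translation u"
  have carr: "carrier ?St = ?c ` linear_stab" by (simp add: u stabilizer_Aut)
  interpret group_action Aut "verts \<Gamma>" "\<lambda>g. g"
    using transitive_Aut by (simp add: transitive_action_def)
  interpret St: group ?St
    using group.subgroup_imp_group[OF group_Aut stabilizer_subgroup[OF x]] .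
  have pow: "?c A [^]\<^bsub>?St\<^esub> n = ?c (A ^^ n)" if "A \<in> linear_stab" for A and n :: nat
    using conj_translation_pow[OF that] by (simp add: nat_pow_def)
  note fp = funpow_linear_stab
  show ?thesis
  proof (rule St.type_C9_C3_C2_if_holomorph[of "?c a" "?c d"])
    show "?c d \<otimes>\<^bsub>?St\<^esub> ?c a = ?c a [^]\<^bsub>?St\<^esub> (2::nat) \<otimes>\<^bsub>?St\<^esub> ?c d"
      using ad rel(3) fp[OF ad(1), of 2] by (simp only: pow) (simp add: conj_translation_mult)
    show "\<exists>i k. g = ?c a [^]\<^bsub>?St\<^esub> (i::nat) \<otimes>\<^bsub>?St\<^esub> ?c d [^]\<^bsub>?St\<^esub> (k::nat)"
      if "g \<in> carrier ?St" for g
    proof -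
      obtain A where A: "A \<in> linear_stab" "g = ?c A" using \<open>g \<in> carrier ?St\<close> carr by blast
      then obtain i k where "A = a ^^ i \<circ> d ^^ k" using gen by blast
      then show ?thesis using A(2) ad fp by (simp only: pow) (auto simp: conj_translation_mult)
    qed
    have "card (?c ` linear_stab) = card linear_stab"
      by (rule card_image) (auto simp: inj_on_def conj_translation_inject)
    then show "order ?St = 54" using card carr by (simp add: order_def)
    show "?c a [^]\<^bsub>?St\<^esub> (9::nat) = \<one>\<^bsub>?St\<^esub>" "?c d [^]\<^bsub>?St\<^esub> (6::nat) = \<one>\<^bsub>?St\<^esub>"
      using ad rel by (simp_all add: pow conj_translation_id del: carr)
  qed (use ad carr in simp_all)
qed

subsection \<open>Fixed vertices\<close>

definition cayley_on :: "'v set \<Rightarrow> 'v graph" where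
  "cayley_on W = graph_of W (\<lambda>x y. x + y \<in> S)"

lemma edge_cayley_on: "{x, y} \<in> edges (cayley_on W) \<longleftrightarrow> x \<in> W \<and> y \<in> W \<and> x + y \<in> S"
proof -
  have "x \<noteq> y" if "x + y \<in> S" using that zero_notin add_self by auto
  then show ?thesis by (auto simp: cayley_on_def graph_of_def doubleton_eq_iff add.commute)
qed

lemma invariants_lift: "invariants (verts \<Gamma>) (\<lambda>g. g) (lift f) = \<psi> ` {x. f x = x}"
  using inj by (auto simp: invariants_def verts_eq inj_eq)

text \<open>Translation by u preserves adjacency and takes the fixed points of the conjugate to the
  fixed space of A.\<close>

lemma induced_fixed_isomorphic:
  assumes A: "A \<in> linear_stab"
  shows "graph_isomorphic (induced_subgraph \<Gamma> (invariants (verts \<Gamma>) (\<lambda>g. g) (conj_translation u A)))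
    (cayley_on {x. A x = x})"
proof -
  define F where "F = {x. affine_map A (u + A u) x = x}"
  define f where "f = (\<lambda>X. u + inv_into UNIV \<psi> X)"
  have f\<psi>: "f (\<psi> x) = u + x" for x using inj by (simp add: f_def)
  have F: "x \<in> F \<longleftrightarrow> A (u + x) = u + x" for x
    using linear_stabD(1)[OF A, of u x]
    by (auto simp: F_def affine_map_def char2) (metis add_self_left add.left_commute)+
  have "bij_betw f (\<psi> ` F) {x. A x = x}"
  proof (rule bij_betw_byWitness[where f' = "\<lambda>y. \<psi> (u + y)"])
    show "f ` \<psi> ` F \<subseteq> {x. A x = x}" by (auto simp: f\<psi> F)
    show "(\<lambda>y. \<psi> (u + y)) ` {x. A x = x} \<subseteq> \<psi> ` F" by (auto simp: F add_self_left)
  qed (auto simp: f\<psi> add_self_left)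
  moreover have "{\<psi> x, \<psi> y} \<in> {e \<in> edges \<Gamma>. e \<subseteq> \<psi> ` F}
      \<longleftrightarrow> {f (\<psi> x), f (\<psi> y)} \<in> edges (cayley_on {x. A x = x})" if "x \<in> F" "y \<in> F" for x y
    using that by (simp add: adjacent edge_cayley_on f\<psi> F char2)
  ultimately have "graph_isomorphism (induced_subgraph \<Gamma> (\<psi> ` F)) (cayley_on {x. A x = x}) f"
    by (auto simp: graph_isomorphism_def induced_subgraph_def) (simp_all add: cayley_on_def graph_of_def)
  then show ?thesis
    by (auto simp: conj_translation_def invariants_lift F_def[symmetric] graph_isomorphic_def)
qed

lemma ord_conj_translation:
  assumes A: "A \<in> linear_stab" and n: "\<And>m. A ^^ m = id \<longleftrightarrow> n dvd m"
  shows "group.ord Aut (conj_translation u A) = n"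
proof -
  interpret group Aut by (rule group_Aut)
  have "conj_translation u A \<in> carrier Aut" using A by (simp add: conj_translation_def affine_in_Aut)
  moreover have "conj_translation u (A ^^ m) = \<one>\<^bsub>Aut\<^esub> \<longleftrightarrow> A ^^ m = id" for m
    using conj_translation_inject[OF funpow_linear_stab[OF A] id_linear_stab, of u m]
    by (simp add: conj_translation_id)
  ultimately show ?thesis by (simp add: ord_unique conj_translation_pow[OF A] n)
qed

lemma ex_order_linear:
  assumes A: "A \<in> linear_stab"
  obtains n where "\<And>m. A ^^ m = id \<longleftrightarrow> n dvd m"
proof -
  interpret group Aut by (rule group_Aut)
  have "conj_translation 0 A \<in> carrier Aut" using A by (simp add: conj_translation_def affine_in_Aut)
  from pow_eq_id[OF this] have "A ^^ m = id \<longleftrightarrow> group.ord Aut (conj_translation 0 A) dvd m" for m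
    using conj_translation_inject[OF funpow_linear_stab[OF A] id_linear_stab, of 0 m]
    by (simp add: conj_translation_pow[OF A] conj_translation_id)
  then show ?thesis by (rule that)
qed

text \<open>In characteristic 2 the centroid of an orbit of odd length is a fixed point.\<close>

lemma odd_order_fixes_vertex:
  assumes A: "A \<in> linear_stab" and r: "odd r" "affine_map A v ^^ r = id"
  shows "\<exists>x. affine_map A v x = x"
proof -
  let ?f = "affine_map A v"
  \<comment> \<open>Dividing by an odd r is trivial in characteristic 2, so the centroid is simply
    the sum over the orbit of 0.\<close>
  define p where "p m = (\<Sum>k<m. (?f ^^ k) 0)" for m
  have "A (p m) = (\<Sum>k<m. (?f ^^ Suc k) 0) + (if odd m then v else 0)" for m
  proof (induction m)
    case (Suc m)
    have "A (p (Suc m)) = A (p m) + A ((?f ^^ m) 0)"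
      by (simp add: p_def linear_stabD(1)[OF A])
    also have "A ((?f ^^ m) 0) = (?f ^^ Suc m) 0 + v" by (simp add: affine_map_def char2)
    finally show ?case unfolding Suc by (auto simp: char2 simp del: funpow.simps)
  qed (simp add: p_def linear_stabD(4)[OF A])
  then have "?f (p r) = (\<Sum>k<r. (?f ^^ Suc k) 0)" using r by (simp add: affine_map_def char2)
  \<comment> \<open>Shifting the index costs nothing: both the missing term for exponent 0 and the
    extra one for exponent r are 0.\<close>
  also have "(\<Sum>k<r. (?f ^^ Suc k) 0) = p (Suc r)"
    unfolding p_def sum.lessThan_Suc_shift by simp
  also have "\<dots> = p r" using r by (simp add: p_def)
  finally show ?thesis by blast
qed

text \<open>The n-th power of the affine map has trivial linear part, so it is a translation and its
  square is the identity; conversely the linear part of the p-th power must be trivial. Thus n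
  divides p and p divides 2n.\<close>

lemma ord_if_no_fixed_vertex:
  assumes A: "A \<in> linear_stab" and n: "\<And>m. A ^^ m = id \<longleftrightarrow> n dvd m"
    and nofix: "\<And>x. affine_map A v x \<noteq> x"
  defines "p \<equiv> group.ord Aut (lift (affine_map A v))"
  shows "even p" and "p = n \<or> p = 2 * n"
proof -
  interpret group Aut by (rule group_Aut)
  let ?f = "affine_map A v"
  have bij: "bij ?f" by (rule bij_affine_map[OF A])
  have p: "?f ^^ m = id \<longleftrightarrow> p dvd m" for m
    unfolding p_def by (simp add: pow_eq_id[symmetric] affine_in_Aut[OF A] lift_pow[OF bij] lift_one)
  show "even p"
    using odd_order_fixes_vertex[OF A, of p v] p[of p] nofix by auto
  have "\<exists>w. ?f ^^ m = affine_map (A ^^ m) w" for m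
  proof (induction m)
    case 0
    have "?f ^^ 0 = affine_map (A ^^ 0) 0" by (simp add: affine_map_def id_def)
    then show ?case by blast
  next
    case (Suc m)
    then obtain w where "?f ^^ m = affine_map (A ^^ m) w" by blast
    then have "?f ^^ Suc m = affine_map (A ^^ Suc m) (A w + v)" by (simp add: affine_map_comp[OF A])
    then show ?case by blast
  qed
  then obtain w where w: "\<And>m. ?f ^^ m = affine_map (A ^^ m) (w m)" by metis
  have "n dvd p"
  proof -
    have "affine_map (A ^^ p) (w p) = affine_map id 0"
      using p[of p] w[of p] by (simp add: affine_map_def id_def)
    then show ?thesis
      using n[of p] affine_map_inject[OF funpow_linear_stab[OF A] id_linear_stab] by blast
  qed
  moreover have "p dvd 2 * n"
  proof -
    have "A ^^ n = id" using n by simp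
    then have "?f ^^ n = affine_map id (w n)" by (simp add: w)
    then have "?f ^^ (2 * n) = id"
      by (simp add: mult_2 funpow_add affine_map_def fun_eq_iff char2)
    then show ?thesis using p by blast
  qed
  ultimately show "p = n \<or> p = 2 * n"
  proof (cases "n = 0")
    case False
    obtain k where k: "p = n * k" using \<open>n dvd p\<close> by blast
    then have "k dvd 2" using \<open>p dvd 2 * n\<close> False by (simp add: mult.commute)
    then have "k \<le> 2" "k \<noteq> 0" using dvd_imp_le[of k 2] by (simp, cases k) auto
    then show ?thesis using k by (auto simp: le_Suc_eq numeral_2_eq_2)
  qed auto
qed

text \<open>B maps the fixed space of A onto that of A' and preserves adjacency. Conjugacy is
  written without inverses so that it can be read off from products of generators.\<close>

lemma cayley_on_fixed_conjugate:
  assumes B: "B \<in> linear_stab" and conj: "A' \<circ> B = B \<circ> A"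
  shows "graph_isomorphic (cayley_on {x. A x = x}) (cayley_on {x. A' x = x})"
    and "A' ^^ m = id \<longleftrightarrow> A ^^ m = id"
proof -
  have *: "A' (B x) = B (A x)" for x using conj by (metis comp_apply)
  have eq: "B x = B y \<longleftrightarrow> x = y" for x y using linear_stabD(2)[OF B] by (simp add: bij_def inj_eq)
  have "bij_betw B {x. A x = x} {x. A' x = x}"
  proof (rule bij_betw_imageI)
    show "B ` {x. A x = x} = {x. A' x = x}"
    proof (intro equalityI subsetI)
      fix x assume x: "x \<in> {x. A' x = x}"
      obtain y where y: "x = B y" using linear_stabD(2)[OF B] by (auto simp: bij_def surj_def)
      then have "A y = y" using x by (simp add: * eq)
      then show "x \<in> B ` {x. A x = x}" using y by simp
    qed (auto simp: *)
  qed (auto simp: inj_on_def eq)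
  then have "graph_isomorphism (cayley_on {x. A x = x}) (cayley_on {x. A' x = x}) B"
    unfolding cayley_on_def
    by (rule graph_isomorphism_graph_of)
      (simp_all add: linear_stabD(1)[OF B, symmetric] linear_stabD(3)[OF B] add.commute)
  then show "graph_isomorphic (cayley_on {x. A x = x}) (cayley_on {x. A' x = x})"
    by (auto simp: graph_isomorphic_def)
  have "(A' ^^ m) (B x) = B ((A ^^ m) x)" for x
    by (induction m) (simp_all add: *)
  note pow = this
  show "A' ^^ m = id \<longleftrightarrow> A ^^ m = id"
  proof
    assume "A' ^^ m = id"
    then show "A ^^ m = id" using pow by (simp add: fun_eq_iff eq)
  next
    assume A: "A ^^ m = id"
    show "A' ^^ m = id"
    proof
      fix x
      obtain y where "x = B y" using linear_stabD(2)[OF B] by (auto simp: bij_def surj_def)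
      then show "(A' ^^ m) x = id x" using pow A by simp
    qed
  qed
qed

end

section \<open>The syndromes of weight one vectors\<close>

declare plus_prod_def [code del] add_Pair [code]

text \<open>Five entries of \<open>f4\<close> encode ten bits; only the additive group is meant. The
  code is not closed under multiplication by \<open>omega\<close>, so scalars from \<open>f4\<close>
  have no meaning for its cosets.\<close>

type_synonym vec5 = "f4 \<times> f4 \<times> f4 \<times> f4 \<times> f4"

lemma f4_add_self [simp]: "x + x = (0::f4)"
  by (cases x) (simp_all add: zero_f4_def)

lemma vec5_add_self: "x + x = (0::vec5)"
  by (cases x) (simp add: zero_prod_def)

lemma vec5_add_self_left: "x + (x + y) = (y::vec5)"
  by (simp add: vec5_add_self flip: add.assoc)

lemmas vec5_char2 = add.assoc add.commute add.left_commute vec5_add_self vec5_add_self_left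

lemma vec5_zero: "(0::vec5) = (F0, F0, F0, F0, F0)"
  by (simp add: zero_prod_def zero_f4_def)

text \<open>Conditionals keep the evaluation by rewriting lazy.\<close>

fun lazy_all :: "('a \<Rightarrow> bool) \<Rightarrow> 'a list \<Rightarrow> bool" where
  "lazy_all P [] = True"
| "lazy_all P (x # xs) = (if P x then lazy_all P xs else False)"

fun lazy_ex :: "('a \<Rightarrow> bool) \<Rightarrow> 'a list \<Rightarrow> bool" where
  "lazy_ex P [] = False"
| "lazy_ex P (x # xs) = (if P x then True else lazy_ex P xs)"

lemma lazy_all_iff: "lazy_all P xs \<longleftrightarrow> (\<forall>x\<in>set xs. P x)"
  by (induction xs) auto

lemma lazy_ex_iff: "lazy_ex P xs \<longleftrightarrow> (\<exists>x\<in>set xs. P x)"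
  by (induction xs) auto

definition f4_list :: "f4 list" where "f4_list = [F0, F1, Fw, Fw2]"

lemma set_f4_list: "set f4_list = UNIV"
  by (auto simp: f4_list_def intro: f4.exhaust)

text \<open>Nested loops run through the 1024 vectors without forming their list.\<close>

definition all_vec5 :: "(vec5 \<Rightarrow> bool) \<Rightarrow> bool" where
  "all_vec5 P = lazy_all (\<lambda>a. lazy_all (\<lambda>b. lazy_all (\<lambda>c. lazy_all (\<lambda>d. lazy_all (\<lambda>e.
     P (a, b, c, d, e)) f4_list) f4_list) f4_list) f4_list) f4_list"

lemma all_vec5D: "all_vec5 P \<Longrightarrow> P v"
  by (cases v) (simp add: all_vec5_def lazy_all_iff set_f4_list)

text \<open>The syndromes of the vectors of weight 1: the \<open>i\<close>-th triple belongs to the entries \<open>1\<close>, \<open>\<omega>\<close>, \<open>\<omega>\<^sup>2\<close>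
  in coordinate \<open>i\<close>. The coordinates 7, 2, 6, 4, 8 (in this order) are the axes of the syndrome space.\<close>

definition lines :: "(vec5 \<times> vec5 \<times> vec5) list" where
  "lines = [
    ((Fw, F0, Fw2, Fw, Fw), (F1, Fw2, F0, Fw2, Fw), (Fw2, Fw2, Fw2, F1, F0)),
    ((F0, F1, F0, F0, F0), (F0, Fw, F0, F0, F0), (F0, Fw2, F0, F0, F0)),
    ((F1, Fw2, Fw, F0, Fw2), (Fw, Fw, F1, Fw, F0), (Fw2, F1, Fw2, Fw, Fw2)),
    ((F0, F0, F0, F1, F0), (F0, F0, F0, Fw, F0), (F0, F0, F0, Fw2, F0)),
    ((Fw, Fw, F0, Fw2, F1), (F1, Fw, Fw, Fw, Fw), (Fw2, F0, Fw, F1, Fw2)),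
    ((F0, F0, F1, F0, F0), (F0, F0, Fw, F0, F0), (F0, F0, Fw2, F0, F0)),
    ((F1, F0, F0, F0, F0), (Fw, F0, F0, F0, F0), (Fw2, F0, F0, F0, F0)),
    ((F0, F0, F0, F0, F1), (F0, F0, F0, F0, Fw), (F0, F0, F0, F0, Fw2)),
    ((Fw, F1, F1, F0, Fw2), (F1, F0, F1, F1, Fw), (Fw2, F1, F0, F1, F1)),
    ((F0, F1, F1, Fw, Fw), (F0, Fw, Fw, F1, F1), (F0, Fw2, Fw2, Fw2, Fw2)),
    ((F1, Fw, F1, F0, F1), (Fw, F1, Fw2, Fw2, F0), (Fw2, Fw2, Fw, Fw2, F1))]"

text \<open>The cyclic rotations let each of the 33 points come first in exactly one triple. The
  opposite orientation of a line is left to the places where it matters.\<close>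

definition flags :: "(vec5 \<times> vec5 \<times> vec5) list" where
  "flags = concat (map (\<lambda>(x, y, z). [(x, y, z), (y, z, x), (z, x, y)]) lines)"

definition points :: "vec5 list" where
  "points = map fst flags"

context begin

private abbreviation (input) Q where "Q \<equiv> case_f4"
private abbreviation (input) T where "T \<equiv> True"
private abbreviation (input) F where "F \<equiv> False"

text \<open>Decision trees for the neighbours of \<open>0\<close> and for the vertices at distance 2 from \<open>0\<close>, so that
  membership is decided by five case distinctions.\<close>

fun is_point :: "vec5 \<Rightarrow> bool" where
  "is_point (a, b, c, d, e) =
    (Q (Q (Q (Q (Q F T T T e) (Q T F F F e) (Q T F F F e) (Q T F F F e) d) (Q (Q T F F F e) F F F
    d) (Q (Q T F F F e) F F F d) (Q (Q T F F F e) F F F d) c) (Q (Q (Q T F F F e) F F F d) (Q F F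
    (Q F F T F e) F d) F F c) (Q (Q (Q T F F F e) F F F d) F (Q F (Q F T F F e) F F d) F c) (Q (Q
    (Q T F F F e) F F F d) F F (Q F F F (Q F F F T e) d) c) b) (Q (Q (Q (Q T F F F e) F F F d) (Q
    F (Q F F T F e) F F d) F F c) F (Q F (Q (Q F T F F e) F F F d) (Q F F (Q F F T F e) F d) F c)
    (Q (Q F F F (Q F F T F e) d) F (Q (Q F F F T e) F F F d) F c) b) (Q (Q (Q (Q T F F F e) F F F
    d) F F (Q F F (Q F F T F e) F d) c) (Q F (Q (Q F F F T e) F F F d) F (Q F F F (Q T F F F e) d)
    c) (Q (Q F F F (Q F T F F e) d) (Q F F (Q T F F F e) F d) F F c) F b) (Q (Q (Q (Q T F F F e) F
    F F d) F (Q F (Q F F F T e) F F d) F c) (Q (Q F (Q F T F F e) F F d) F F (Q F F (Q F F F T e)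
    F d) c) F (Q F F (Q F F F (Q F T F F e) d) (Q F (Q T F F F e) F F d) c) b) a)"

fun is_dist2 :: "vec5 \<Rightarrow> bool" where
  "is_dist2 (a, b, c, d, e) =
    (Q (Q (Q (Q F (Q F T T T e) (Q F T T T e) (Q F T T T e) d) (Q (Q F T T T e) (Q T T T F e) (Q T
    T T F e) (Q T F F F e) d) (Q (Q F T T T e) (Q T T F T e) (Q T F F F e) (Q T T F T e) d) (Q (Q
    F T T T e) (Q T F F F e) (Q T F T T e) (Q T F T T e) d) c) (Q (Q (Q F T T T e) (Q T T T F e)
    (Q T T T F e) (Q T F F F e) d) (Q (Q T F T T e) (Q F F T F e) (Q T T F T e) (Q T F T T e) d)
    (Q (Q T F T F e) (Q T T F F e) (Q F T T F e) F d) (Q (Q T F T F e) F (Q F F T T e) (Q T F F T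
    e) d) c) (Q (Q (Q F T T T e) (Q T T F T e) (Q T F F F e) (Q T T F T e) d) (Q (Q T T F F e) (Q
    F T T F e) (Q T F T F e) F d) (Q (Q T T T F e) (Q T F T T e) (Q T T T F e) (Q F T F F e) d) (Q
    (Q T T F F e) (Q F T F T e) F (Q T F F T e) d) c) (Q (Q (Q F T T T e) (Q T F F F e) (Q T F T T
    e) (Q T F T T e) d) (Q (Q T F F T e) F (Q T F T F e) (Q F F T T e) d) (Q (Q T F F T e) (Q T T
    F F e) F (Q F T F T e) d) (Q (Q T T F T e) (Q T T F T e) (Q F F F T e) (Q T T T F e) d) c) b)
    (Q (Q (Q (Q F T T T e) (Q T F T T e) (Q T F F F e) (Q T F T T e) d) (Q (Q T T T F e) (Q T T F
    T e) (Q F F T F e) (Q T T T F e) d) (Q (Q T F F T e) (Q F F T T e) (Q T F T F e) F d) (Q (Q T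
    T F F e) (Q T F T F e) (Q F T T F e) F d) c) (Q (Q (Q T T F F e) (Q F T T F e) F (Q T F T F e)
    d) (Q (Q F T F T e) (Q F T T F e) (Q F F T T e) F d) (Q (Q T F F T e) F (Q F F T T e) (Q T F T
    F e) d) (Q F (Q T T F F e) (Q F T F T e) (Q T F F T e) d) c) (Q (Q (Q T T F F e) F (Q T F T F
    e) (Q F T T F e) d) (Q (Q T F T T e) (Q T T T F e) (Q T T T F e) (Q F T F F e) d) (Q (Q F T T
    T e) (Q F T T T e) (Q T T F T e) (Q F F T F e) d) (Q (Q F T F T e) F (Q F T T F e) (Q F F T T
    e) d) c) (Q (Q (Q T F T T e) (Q F F T F e) (Q T F T T e) (Q T T F T e) d) (Q (Q F T F T e) (Q
    F F T T e) F (Q F T T F e) d) (Q (Q T T T F e) (Q F F F T e) (Q F T T T e) (Q F T T T e) d) (Q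
    (Q T F F T e) (Q T F T F e) F (Q F F T T e) d) c) b) (Q (Q (Q (Q F T T T e) (Q T F F F e) (Q T
    T T F e) (Q T T T F e) d) (Q (Q T F F T e) (Q F F T T e) (Q T F T F e) F d) (Q (Q T F F T e)
    (Q F F T T e) (Q T F T F e) F d) (Q (Q T T T F e) (Q F F T F e) (Q T T F T e) (Q T T T F e) d)
    c) (Q (Q (Q T F F T e) (Q F T F T e) F (Q T T F F e) d) (Q (Q T T T F e) (Q F F F T e) (Q T F
    T T e) (Q T F T T e) d) (Q (Q T F F T e) (Q F T F T e) F (Q T T F F e) d) (Q (Q T F T T e) (Q
    T F F F e) (Q T F T T e) (Q F T T T e) d) c) (Q (Q (Q T T F T e) (Q F T F F e) (Q T T F T e)
    (Q T F T T e) d) (Q (Q T T F T e) (Q T F F F e) (Q F T T T e) (Q T T F T e) d) (Q F (Q F T T F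
    e) (Q T F T F e) (Q T T F F e) d) (Q F (Q F T T F e) (Q T F T F e) (Q T T F F e) d) c) (Q (Q
    (Q T F T F e) (Q T T F F e) F (Q F T T F e) d) (Q (Q F T F T e) (Q T F F T e) (Q T T F F e) F
    d) (Q (Q F F T T e) F (Q F T T F e) (Q F T F T e) d) (Q F (Q T F T F e) (Q F F T T e) (Q T F F
    T e) d) c) b) (Q (Q (Q (Q F T T T e) (Q T T F T e) (Q T T F T e) (Q T F F F e) d) (Q (Q T F T
    F e) (Q F F T T e) F (Q T F F T e) d) (Q (Q T T F T e) (Q T T T F e) (Q F F F T e) (Q T T F T
    e) d) (Q (Q T F T F e) (Q T F F T e) (Q F F T T e) F d) c) (Q (Q (Q T T F T e) (Q T F T T e)
    (Q T T F T e) (Q F T F F e) d) (Q (Q F T F T e) (Q F T T F e) (Q F F T T e) F d) (Q F (Q F T F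
    T e) (Q F F T T e) (Q F T T F e) d) (Q (Q F F F T e) (Q T T F T e) (Q T T T F e) (Q T T F T e)
    d) c) (Q (Q (Q T F T F e) (Q T T F F e) F (Q F T T F e) d) (Q (Q T T F F e) F (Q T F F T e) (Q
    F T F T e) d) (Q F (Q F T F T e) (Q F F T T e) (Q F T T F e) d) (Q (Q T F T F e) (Q T F F T e)
    (Q F F T T e) F d) c) (Q (Q (Q T F T F e) (Q T T F F e) F (Q F T T F e) d) (Q F (Q T F T F e)
    (Q T T F F e) (Q F T T F e) d) (Q (Q T T F T e) (Q T T F T e) (Q F T F F e) (Q T F T T e) d)
    (Q (Q T F F F e) (Q F T T T e) (Q T T F T e) (Q T T F T e) d) c) b) a)"

end

section \<open>Properties of the connection set, established by evaluation\<close>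

declare is_point.simps [simp del] is_dist2.simps [simp del]

text \<open>The tree is compared with the list in both directions, over the points and over all
  vectors, so nothing depends on how it was found.\<close>

lemma is_point_iff: "is_point v \<longleftrightarrow> v \<in> set points"
proof -
  have "lazy_all is_point points" by code_simp
  moreover have "all_vec5 (\<lambda>v. if is_point v then lazy_ex (\<lambda>s. s = v) points else True)" by code_simp
  from all_vec5D[OF this, of v] have "is_point v \<Longrightarrow> v \<in> set points" by (simp add: lazy_ex_iff)
  ultimately show ?thesis by (auto simp: lazy_all_iff)
qed

text \<open>This describes the tree by addition and the point set alone, which makes it invariant
  under linear maps that permute the points.\<close>

lemma is_dist2_iff:
  "is_dist2 v \<longleftrightarrow> v \<noteq> 0 \<and> v \<notin> set points \<and> (\<exists>s\<in>set points. v + s \<in> set points)"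
proof -
  have "all_vec5 (\<lambda>v. is_dist2 v =
    (if v = (F0, F0, F0, F0, F0) then False else if is_point v then False
     else lazy_ex (\<lambda>s. is_point (v + s)) points))"
    by code_simp
  from all_vec5D[OF this, of v] show ?thesis by (simp add: lazy_ex_iff is_point_iff vec5_zero)
qed

text \<open>A second way of writing s + t would give a nonzero codeword of weight at most 4. The
  check runs over three points only, since the fourth is determined by them.\<close>

lemma points_sidon:
  assumes "s \<in> set points" "t \<in> set points" "s' \<in> set points" "t' \<in> set points"
    and eq: "s + t = s' + t'" and "s \<noteq> t" "s + t \<notin> set points"
  shows "s' = s \<or> s' = t"
proof -
  have "lazy_all (\<lambda>s. lazy_all (\<lambda>t. if is_dist2 (s + t) then
      lazy_all (\<lambda>u. if is_point (s + t + u) then (if u = s then True else u = t) else True) points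
      else True) points) points"
    by code_simp
  moreover have "s + t + s' = t'" unfolding eq by (simp add: vec5_char2)
  moreover have "s + t \<noteq> 0" using \<open>s \<noteq> t\<close> by (metis add_0_right vec5_add_self_left)
  moreover have "is_dist2 (s + t)"
  proof -
    have "s + t + s = t" by (simp add: vec5_char2)
    then have "s + t + s \<in> set points" using assms by simp
    then show ?thesis using assms \<open>s + t \<noteq> 0\<close> unfolding is_dist2_iff by blast
  qed
  ultimately show ?thesis
    using assms(1-4) by (auto simp: lazy_all_iff is_point_iff split: if_splits)
qed

text \<open>Two adjacent neighbours of 0 belong to the same coordinate; the two alternatives are the
  two orientations of its line when s comes first.\<close>

lemma points_flag:
  assumes "s \<in> set points" "t \<in> set points" "s + t \<in> set points"
  shows "(s, t, s + t) \<in> set flags \<or> (s, s + t, t) \<in> set flags"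
proof -
  have "lazy_all (\<lambda>s. lazy_all (\<lambda>t. if is_point (s + t) then
      lazy_ex (\<lambda>f. if f = (s, t, s + t) then True else f = (s, s + t, t)) flags else True) points) points"
    by code_simp
  then show ?thesis
    using assms by (auto simp: lazy_all_iff lazy_ex_iff is_point_iff split: if_splits)
qed

lemma points_triangle:
  assumes "s \<in> set points" "t \<in> set points" "u \<in> set points"
    "s + t \<in> set points" "s + u \<in> set points" "t + u \<in> set points"
  shows "u = s + t"
proof -
  have "lazy_all (\<lambda>s. lazy_all (\<lambda>t. if is_point (s + t) then
      lazy_all (\<lambda>u. if is_point (s + u) then if is_point (t + u) then u = s + t else True else True)
        points else True) points) points"
    by code_simp
  then show ?thesis
    using assms by (auto simp: lazy_all_iff is_point_iff split: if_splits)
qed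

lemma zero_notin_points: "0 \<notin> set points"
  unfolding is_point_iff[symmetric] vec5_zero by code_simp

text \<open>The five axis lines contain all nonzero vectors supported on a single entry, so five
  steps, some possibly zero, reach every vector.\<close>

lemma points_generate:
  assumes 0: "P 0" and step: "\<And>x s. P x \<Longrightarrow> s \<in> set points \<Longrightarrow> P (x + s)"
  shows "P (v::vec5)"
proof -
  have axis: "s = 0 \<or> s \<in> set points"
    if "\<exists>x. s \<in> {(x, F0, F0, F0, F0), (F0, x, F0, F0, F0), (F0, F0, x, F0, F0), (F0, F0, F0, x, F0),
      (F0, F0, F0, F0, x)}" for s
  proof -
    obtain x where "s \<in> {(x, F0, F0, F0, F0), (F0, x, F0, F0, F0), (F0, F0, x, F0, F0),
      (F0, F0, F0, x, F0), (F0, F0, F0, F0, x)}" using \<open>\<exists>x. _\<close> by blast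
    then show ?thesis
      unfolding is_point_iff[symmetric] vec5_zero by (cases x) (auto simp: is_point.simps)
  qed
  have step': "P (y + s)" if "P y" and s: "s = 0 \<or> s \<in> set points" for s y
    using s step[OF \<open>P y\<close>, of s] \<open>P y\<close> by (cases "s = 0") simp_all
  obtain a b c d e where v: "v = (a, b, c, d, e)" by (cases v)
  have "v = 0 + (a, F0, F0, F0, F0) + (F0, b, F0, F0, F0) + (F0, F0, c, F0, F0) +
      (F0, F0, F0, d, F0) + (F0, F0, F0, F0, e)"
    by (simp add: v zero_prod_def flip: zero_f4_def)
  also have "P \<dots>"
    by (intro step' 0 axis[where s = "(a, F0, F0, F0, F0)"] axis[where s = "(F0, b, F0, F0, F0)"]
        axis[where s = "(F0, F0, c, F0, F0)"] axis[where s = "(F0, F0, F0, d, F0)"]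
        axis[where s = "(F0, F0, F0, F0, e)"]) auto
  finally show ?thesis .
qed

section \<open>The coset graph as a Cayley graph\<close>

lemma exhaust_11:
  "(i::11) = 1 \<or> i = 2 \<or> i = 3 \<or> i = 4 \<or> i = 5 \<or> i = 6 \<or> i = 7 \<or> i = 8 \<or> i = 9 \<or> i = 10 \<or> i = 11"
proof (induct i)
  case (of_int z)
  then have "0 \<le> z" "z < 11" by simp_all
  then have "z = 0 \<or> z = 1 \<or> z = 2 \<or> z = 3 \<or> z = 4 \<or> z = 5 \<or> z = 6 \<or> z = 7 \<or> z = 8 \<or> z = 9 \<or> z = 10"
    by arith
  then show ?case by auto
qed

lemma forall_11:
  "(\<forall>i::11. P i) \<longleftrightarrow> P 1 \<and> P 2 \<and> P 3 \<and> P 4 \<and> P 5 \<and> P 6 \<and> P 7 \<and> P 8 \<and> P 9 \<and> P 10 \<and> P 11"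
  by (metis exhaust_11)

lemma UNIV_11: "(UNIV :: 11 set) = {1, 2, 3, 4, 5, 6, 7, 8, 9, 10, 11}"
  using exhaust_11 by auto

lemma sum_11: "sum f (UNIV :: 11 set) = f 1 + f 2 + f 3 + f 4 + f 5 + f 6 + f 7 + f 8 + f 9 + f 10 + f 11"
  unfolding UNIV_11 by (simp add: add.assoc)

lemma vector_11:
  fixes x1 x2 x3 x4 x5 x6 x7 x8 x9 x10 x11 :: "'a::zero"
  defines "v \<equiv> vector [x1, x2, x3, x4, x5, x6, x7, x8, x9, x10, x11] :: 'a ^ 11"
  shows "v $ 1 = x1" "v $ 2 = x2" "v $ 3 = x3" "v $ 4 = x4" "v $ 5 = x5" "v $ 6 = x6" "v $ 7 = x7"
    "v $ 8 = x8" "v $ 9 = x9" "v $ 10 = x10" "v $ 11 = x11"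
  unfolding v_def vector_def by simp_all

text \<open>The additive map on \<open>f4\<close> with 1 and \<open>omega\<close> sent to p and q;
  it is additive only when r = p + q.\<close>

fun on_line :: "vec5 \<times> vec5 \<times> vec5 \<Rightarrow> f4 \<Rightarrow> vec5" where
  "on_line (p, q, r) F0 = 0"
| "on_line (p, q, r) F1 = p"
| "on_line (p, q, r) Fw = q"
| "on_line (p, q, r) Fw2 = r"

text \<open>Since the code is only additive, a coordinate contributes an additive map on
  \<open>f4\<close> where a linear code has a column of a parity check matrix.\<close>

definition syn_col :: "11 \<Rightarrow> f4 \<Rightarrow> vec5" where
  "syn_col i = on_line (vector lines $ i)"

definition syndrome :: "f4 ^ 11 \<Rightarrow> vec5" where
  "syndrome x = (\<Sum>i\<in>UNIV. syn_col i (x $ i))"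

text \<open>The entries go to the axis coordinates 7, 2, 6, 4, 8, where the syndrome just copies the
  entry; this is therefore a section of the syndrome map.\<close>

fun coset_rep :: "vec5 \<Rightarrow> f4 ^ 11" where
  "coset_rep (a, b, c, d, e) = vector [0, b, 0, d, 0, c, a, e, 0, 0, 0]"

lemma syn_col_eq:
  "syn_col 1 = on_line ((Fw, F0, Fw2, Fw, Fw), (F1, Fw2, F0, Fw2, Fw), (Fw2, Fw2, Fw2, F1, F0))"
    "syn_col 2 = on_line ((F0, F1, F0, F0, F0), (F0, Fw, F0, F0, F0), (F0, Fw2, F0, F0, F0))"
    "syn_col 3 = on_line ((F1, Fw2, Fw, F0, Fw2), (Fw, Fw, F1, Fw, F0), (Fw2, F1, Fw2, Fw, Fw2))"
    "syn_col 4 = on_line ((F0, F0, F0, F1, F0), (F0, F0, F0, Fw, F0), (F0, F0, F0, Fw2, F0))"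
    "syn_col 5 = on_line ((Fw, Fw, F0, Fw2, F1), (F1, Fw, Fw, Fw, Fw), (Fw2, F0, Fw, F1, Fw2))"
    "syn_col 6 = on_line ((F0, F0, F1, F0, F0), (F0, F0, Fw, F0, F0), (F0, F0, Fw2, F0, F0))"
    "syn_col 7 = on_line ((F1, F0, F0, F0, F0), (Fw, F0, F0, F0, F0), (Fw2, F0, F0, F0, F0))"
    "syn_col 8 = on_line ((F0, F0, F0, F0, F1), (F0, F0, F0, F0, Fw), (F0, F0, F0, F0, Fw2))"
    "syn_col 9 = on_line ((Fw, F1, F1, F0, Fw2), (F1, F0, F1, F1, Fw), (Fw2, F1, F0, F1, F1))"
    "syn_col 10 = on_line ((F0, F1, F1, Fw, Fw), (F0, Fw, Fw, F1, F1), (F0, Fw2, Fw2, Fw2, Fw2))"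
    "syn_col 11 = on_line ((F1, Fw, F1, F0, F1), (Fw, F1, Fw2, Fw2, F0), (Fw2, Fw2, Fw, Fw2, F1))"
  by (simp_all add: syn_col_def lines_def vector_11)

lemma syn_col_zero [simp]: "syn_col i 0 = 0"
  by (cases "vector lines $ i") (simp add: syn_col_def zero_f4_def)

lemma syn_col_add: "syn_col i (x + y) = syn_col i x + syn_col i y"
proof -
  have "lazy_all (\<lambda>l. lazy_all (\<lambda>x. lazy_all (\<lambda>y. on_line l (x + y) = on_line l x + on_line l y)
      f4_list) f4_list) lines"
    unfolding vec5_zero[symmetric] by code_simp
  moreover have "vector lines $ i \<in> set lines"
    using exhaust_11[of i] by (auto simp: lines_def vector_11)
  ultimately show ?thesis by (simp add: lazy_all_iff syn_col_def set_f4_list)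
qed

lemma syndrome_add: "syndrome (x + y) = syndrome x + syndrome y"
  by (simp add: syndrome_def syn_col_add sum.distrib)

lemma syndrome_zero: "syndrome 0 = 0"
  by (simp add: syndrome_def)

lemma syndrome_axis: "syndrome (axis i a) = syn_col i a"
proof -
  have "syndrome (axis i a) = (\<Sum>j\<in>UNIV. if j = i then syn_col i a else 0)"
    unfolding syndrome_def by (rule sum.cong) (auto simp: axis_def)
  then show ?thesis by simp
qed

lemma coset_rep_add: "coset_rep (u + v) = coset_rep u + coset_rep v"
  by (cases u; cases v) (simp add: vec_eq_iff forall_11 vector_11)

lemma syndrome_coset_rep: "syndrome (coset_rep v) = v"
proof -
  obtain a b c d e where v: "v = (a, b, c, d, e)" by (cases v)
  have "syn_col 7 x = (x, 0, 0, 0, 0)" "syn_col 2 x = (0, x, 0, 0, 0)" "syn_col 6 x = (0, 0, x, 0, 0)"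
    "syn_col 4 x = (0, 0, 0, x, 0)" "syn_col 8 x = (0, 0, 0, 0, x)" for x
    unfolding syn_col_eq zero_f4_def by (cases x; simp add: vec5_zero)+
  then show ?thesis by (simp add: v syndrome_def sum_11 vector_11)
qed

lemma set_points: "set points = {syn_col i a | i a. a \<noteq> 0}"
proof (intro equalityI subsetI)
  fix p assume "p \<in> set points"
  then obtain l where l: "l \<in> set lines" "p \<in> {fst l, fst (snd l), snd (snd l)}"
    by (auto simp: points_def flags_def)
  obtain x y z where xyz: "l = (x, y, z)" by (cases l)
  then have "p = on_line l F1 \<or> p = on_line l Fw \<or> p = on_line l Fw2" using l(2) by auto
  then obtain a where a: "a \<noteq> 0" "p = on_line l a" by (auto simp: zero_f4_def)
  have "\<exists>i. l = vector lines $ (i :: 11)"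
  proof -
    have "l \<in> set (map (\<lambda>i::11. vector lines $ i) [1, 2, 3, 4, 5, 6, 7, 8, 9, 10, 11])"
      using l(1) by (simp add: lines_def vector_11)
    then show ?thesis by auto
  qed
  then show "p \<in> {syn_col i a | i a. a \<noteq> 0}" using a by (auto simp: syn_col_def)
next
  fix p assume "p \<in> {syn_col i a | i a. a \<noteq> 0}"
  then obtain i a where p: "p = syn_col i a" "a \<noteq> 0" by blast
  obtain x y z where l: "vector lines $ i = (x, y, z)" by (cases "vector lines $ i")
  have "vector lines $ i \<in> set lines"
    using exhaust_11[of i] by (auto simp: lines_def vector_11)
  then have "set ((\<lambda>(x, y, z). [(x, y, z), (y, z, x), (z, x, y)]) (x, y, z)) \<subseteq> set flags"
    unfolding l flags_def set_concat set_map by blast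
  then have "(x, y, z) \<in> set flags" "(y, z, x) \<in> set flags" "(z, x, y) \<in> set flags" by auto
  then have "x \<in> set points" "y \<in> set points" "z \<in> set points"
    unfolding points_def set_map by (auto intro: rev_image_eqI simp del: split_paired_Ex)
  then show "p \<in> set points" using p l by (cases a) (auto simp: syn_col_def zero_f4_def)
qed

section \<open>The code as the kernel of the syndrome map\<close>

lemma F2_span_add:
  assumes "x \<in> F2_span B" "y \<in> F2_span B"
  shows "x + y \<in> F2_span B"
proof -
  obtain c c' where "x = (\<Sum>b\<in>B. c b *s b)" "y = (\<Sum>b\<in>B. c' b *s b)"
    and cc: "\<forall>b\<in>B. c b \<in> {0, 1}" "\<forall>b\<in>B. c' b \<in> {0, 1}"
    using assms unfolding F2_span_def by auto
  then have "x + y = (\<Sum>b\<in>B. (c b + c' b) *s b)"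
    by (simp add: sum.distrib vector_sadd_rdistrib)
  moreover have "\<forall>b\<in>B. c b + c' b \<in> {0, 1}" using cc by force
  ultimately show ?thesis
    unfolding F2_span_def by (intro CollectI exI[of _ "\<lambda>b. c b + c' b"] conjI)
qed

lemma F2_span_base:
  assumes "finite B" "b \<in> B"
  shows "b \<in> F2_span B"
proof -
  have "(\<Sum>b'\<in>B. (if b' = b then 1 else 0) *s b') = (\<Sum>b'\<in>B. if b' = b then b else 0)"
    by (rule sum.cong) auto
  then have "b = (\<Sum>b'\<in>B. (if b' = b then 1 else 0) *s b')" using assms by simp
  then show ?thesis unfolding F2_span_def by force
qed

lemma F2_span_zero: "0 \<in> F2_span B"
  unfolding F2_span_def by (auto intro!: exI[of _ "\<lambda>_. 0"])

lemma D_minus_add: "x \<in> D_minus \<Longrightarrow> y \<in> D_minus \<Longrightarrow> x + y \<in> D_minus"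
  unfolding D_minus_def by (rule F2_span_add)

lemma D_minus_sum: "(\<And>i. i \<in> X \<Longrightarrow> f i \<in> D_minus) \<Longrightarrow> sum f X \<in> D_minus"
  by (induction X rule: infinite_finite_induct) (simp_all add: D_minus_add, simp_all add: D_minus_def F2_span_zero)

lemma syndrome_F2_span:
  assumes "x \<in> F2_span B" and B: "\<forall>b\<in>B. syndrome b = 0"
  shows "syndrome x = 0"
proof -
  obtain c where x: "x = (\<Sum>b\<in>B. c b *s b)" and c: "\<forall>b\<in>B. c b \<in> {0, 1}"
    using assms(1) by (auto simp: F2_span_def)
  have "syndrome (sum f X) = (\<Sum>i\<in>X. syndrome (f i))" for f and X :: "(f4 ^ 11) set"
    by (induction X rule: infinite_finite_induct) (simp_all add: syndrome_add syndrome_zero)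
  moreover have "syndrome (c b *s b) = 0" if "b \<in> B" for b
    using c B \<open>b \<in> B\<close> syndrome_zero by fastforce
  ultimately show ?thesis by (simp add: x)
qed

lemma syndrome_D_minus: "x \<in> D_minus \<Longrightarrow> syndrome x = 0"
  unfolding D_minus_def
  by (erule syndrome_F2_span)
    (simp add: syndrome_def sum_11 vector_11 syn_col_eq zero_f4_def one_f4_def power2_eq_square
      vec5_zero)

text \<open>These sums have syndrome 0 and generate the kernel. Having them in the code gives the
  inclusion of the kernel in \<open>D_minus\<close> without counting dimensions.\<close>

lemma reduced_in_D_minus: "axis i a + coset_rep (syn_col i a) \<in> D_minus"
proof -
  define g1 :: "f4 ^ 11" where "g1 = vector [0, 0, 0, 0, 0, \<omega>\<^sup>2, \<omega>\<^sup>2, 0, \<omega>, 1, \<omega>]"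
  define g2 :: "f4 ^ 11" where "g2 = vector [0, 0, 0, 0, 0, \<omega>, 0, \<omega>, \<omega>, \<omega>, 1]"
  define g3 :: "f4 ^ 11" where "g3 = vector [1, 0, 0, 0, 0, 1, 0, 1, \<omega>\<^sup>2, \<omega>\<^sup>2, 1]"
  define g4 :: "f4 ^ 11" where "g4 = vector [\<omega>, 0, 0, 0, 0, 0, \<omega>, 1, \<omega>, \<omega>, \<omega>]"
  define g5 :: "f4 ^ 11" where "g5 = vector [0, 1, 0, 0, 0, 0, 1, 1, 1, \<omega>\<^sup>2, \<omega>\<^sup>2]"
  define g6 :: "f4 ^ 11" where "g6 = vector [0, \<omega>, 0, 0, 0, \<omega>\<^sup>2, 1, \<omega>\<^sup>2, \<omega>, \<omega>, 0]"
  define g7 :: "f4 ^ 11" where "g7 = vector [0, 0, 1, 0, 0, \<omega>, \<omega>, 1, 1, 0, 1]"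
  define g8 :: "f4 ^ 11" where "g8 = vector [0, 0, \<omega>, 0, 0, \<omega>, 1, \<omega>, \<omega>\<^sup>2, \<omega>\<^sup>2, 0]"
  define g9 :: "f4 ^ 11" where "g9 = vector [0, 0, 0, 1, 0, \<omega>, \<omega>, \<omega>, 0, 1, \<omega>]"
  define g10 :: "f4 ^ 11" where "g10 = vector [0, 0, 0, \<omega>, 0, \<omega>\<^sup>2, 1, 1, \<omega>\<^sup>2, 0, \<omega>]"
  define g11 :: "f4 ^ 11" where "g11 = vector [0, 0, 0, 0, 1, \<omega>\<^sup>2, \<omega>\<^sup>2, \<omega>\<^sup>2, 1, 0, \<omega>\<^sup>2]"
  define g12 :: "f4 ^ 11" where "g12 = vector [0, 0, 0, 0, \<omega>, \<omega>, 1, 0, 1, \<omega>, \<omega>]"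
  have g: "g1 \<in> D_minus" "g2 \<in> D_minus" "g3 \<in> D_minus" "g4 \<in> D_minus" "g5 \<in> D_minus" "g6 \<in> D_minus" "g7 \<in> D_minus" "g8 \<in> D_minus" "g9 \<in> D_minus" "g10 \<in> D_minus" "g11 \<in> D_minus" "g12 \<in> D_minus"
    unfolding g1_def g2_def g3_def g4_def g5_def g6_def g7_def g8_def g9_def g10_def g11_def g12_def D_minus_def by (rule F2_span_base; simp)+
  \<comment> \<open>Gaussian elimination: a systematic basis of the code with respect to the coordinates that are not axes.\<close>
  have eq:
    "axis 1 F1 + coset_rep (Fw, F0, Fw2, Fw, Fw) = g1 + g2 + g3 + g10"
    "axis 1 Fw + coset_rep (F1, Fw2, F0, Fw2, Fw) = g2 + g4 + g5 + g6 + g9 + g10"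
    "axis 3 F1 + coset_rep (F1, Fw2, Fw, F0, Fw2) = g1 + g5 + g6 + g7"
    "axis 3 Fw + coset_rep (Fw, Fw, F1, Fw, F0) = g1 + g6 + g8 + g10"
    "axis 5 F1 + coset_rep (Fw, Fw, F0, Fw2, F1) = g1 + g2 + g6 + g9 + g10 + g11"
    "axis 5 Fw + coset_rep (F1, Fw, Fw, Fw, Fw) = g6 + g10 + g12"
    "axis 9 F1 + coset_rep (Fw, F1, F1, F0, Fw2) = g1 + g2 + g5"
    "axis 9 Fw + coset_rep (F1, F0, F1, F1, Fw) = g1 + g9"
    "axis 10 F1 + coset_rep (F0, F1, F1, Fw, Fw) = g2 + g5 + g10"
    "axis 10 Fw + coset_rep (F0, Fw, Fw, F1, F1) = g1 + g6 + g9"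
    "axis 11 F1 + coset_rep (F1, Fw, F1, F0, F1) = g2 + g6"
    "axis 11 Fw + coset_rep (Fw, F1, Fw2, Fw2, F0) = g2 + g5 + g9 + g10"
    unfolding g1_def g2_def g3_def g4_def g5_def g6_def g7_def g8_def g9_def g10_def g11_def g12_def
    by (simp_all add: vec_eq_iff forall_11 vector_11 axis_def zero_f4_def one_f4_def power2_eq_square)
  have zero: "0 \<in> D_minus" by (simp add: D_minus_def F2_span_zero)
  \<comment> \<open>On the axis coordinates the sum cancels to 0; the other six coordinates are the
    twelve vectors of \<open>eq\<close>. The entries 0 and \<open>Fw2\<close> follow by
    additivity.\<close>
  have base: "axis i F1 + coset_rep (syn_col i F1) \<in> D_minus \<and> axis i Fw + coset_rep (syn_col i Fw) \<in> D_minus"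
  proof -
    have "axis i a + coset_rep (syn_col i a) = 0" if "i \<in> {2, 4, 6, 7, 8}" for a
      using that by (cases a) (auto simp: syn_col_eq vec5_zero vec_eq_iff forall_11 vector_11 axis_def zero_f4_def)
    then have "i \<in> {2, 4, 6, 7, 8} \<Longrightarrow> ?thesis" using zero by simp
    moreover have "i \<in> {1, 3, 5, 9, 10, 11} \<Longrightarrow> ?thesis"
      using g by (elim insertE emptyE)
        (simp_all add: syn_col_eq eq D_minus_add del: coset_rep.simps)
    ultimately show ?thesis using exhaust_11[of i] by blast
  qed
  moreover have "axis i Fw2 + coset_rep (syn_col i Fw2) =
    (axis i F1 + coset_rep (syn_col i F1)) + (axis i Fw + coset_rep (syn_col i Fw))"
  proof -
    have "axis i Fw2 = axis i F1 + (axis i Fw :: f4 ^ 11)" by (simp add: vec_eq_iff axis_def)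
    moreover have "syn_col i Fw2 = syn_col i F1 + syn_col i Fw" using syn_col_add[of i F1 Fw] by simp
    ultimately show ?thesis by (simp add: coset_rep_add add_ac)
  qed
  moreover have "axis i F0 + coset_rep (syn_col i F0) = 0"
    using syn_col_zero[of i] unfolding zero_f4_def[symmetric]
    by (simp add: vec_eq_iff axis_def zero_prod_def forall_11 vector_11)
  ultimately show ?thesis using zero D_minus_add by (cases a) auto
qed

text \<open>A vector is the sum of its entries placed on the coordinates, and every summand can be
  reduced separately.\<close>

lemma add_coset_rep_syndrome_in_D_minus: "x + coset_rep (syndrome x) \<in> D_minus"
proof -
  have "coset_rep 0 = 0" by (simp add: zero_prod_def vec_eq_iff forall_11 vector_11)
  then have "coset_rep (sum f X) = (\<Sum>i\<in>X. coset_rep (f i))" for f and X :: "11 set"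
    by (induction X rule: infinite_finite_induct) (simp_all add: coset_rep_add)
  moreover have "(\<Sum>i\<in>UNIV. axis i (x $ i)) = x"
    by (simp add: vec_eq_iff axis_def)
  ultimately have "x + coset_rep (syndrome x) = (\<Sum>i\<in>UNIV. axis i (x $ i) + coset_rep (syn_col i (x $ i)))"
    by (simp add: sum.distrib syndrome_def)
  also have "\<dots> \<in> D_minus" by (rule D_minus_sum) (rule reduced_in_D_minus)
  finally show ?thesis .
qed

lemma D_minus_iff: "x \<in> D_minus \<longleftrightarrow> syndrome x = 0"
proof
  assume "syndrome x = 0"
  moreover have "coset_rep 0 = 0" by (simp add: zero_prod_def vec_eq_iff forall_11 vector_11)
  ultimately show "x \<in> D_minus" using add_coset_rep_syndrome_in_D_minus[of x] by simp
qed (rule syndrome_D_minus)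

lemma code_add_self: "x + x = (0 :: f4 ^ 11)"
  unfolding vec_eq_iff by (simp only: vector_add_component f4_add_self zero_index) simp

lemma code_add_self_left: "x + (x + y) = (y :: f4 ^ 11)"
  by (simp add: code_add_self flip: add.assoc)

definition coset_of :: "vec5 \<Rightarrow> (f4 ^ 11) set" where
  "coset_of v = {x. syndrome x = v}"

lemma coset_eq: "(+) x ` D_minus = coset_of (syndrome x)"
proof (intro equalityI subsetI)
  fix y assume "y \<in> coset_of (syndrome x)"
  then have "x + y \<in> D_minus" by (simp add: coset_of_def D_minus_iff syndrome_add vec5_add_self)
  then show "y \<in> (+) x ` D_minus" by (rule rev_image_eqI) (simp add: code_add_self_left)
qed (auto simp: coset_of_def D_minus_iff syndrome_add)

lemma hamming_weight_1_iff: "hamming_weight x = 1 \<longleftrightarrow> (\<exists>i a. a \<noteq> 0 \<and> x = axis i a)"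
proof
  assume "hamming_weight x = 1"
  then obtain i where "{i. x $ i \<noteq> 0} = {i}" unfolding hamming_weight_def by (rule card_1_singletonE)
  then have "x = axis i (x $ i)" "x $ i \<noteq> 0" by (auto simp: vec_eq_iff axis_def)
  then show "\<exists>i a. a \<noteq> 0 \<and> x = axis i a" by blast
next
  assume "\<exists>i a. a \<noteq> 0 \<and> x = axis i a"
  then obtain i a where "a \<noteq> 0" "x = axis i a" by blast
  then have "{j. x $ j \<noteq> 0} = {i}" by (auto simp: axis_def)
  then show "hamming_weight x = 1" by (simp add: hamming_weight_def)
qed

lemma inj_coset_of: "inj coset_of"
proof (rule injI)
  fix u v assume eq: "coset_of u = coset_of v"
  have "coset_rep u \<in> coset_of u" by (simp add: coset_of_def syndrome_coset_rep)
  then show "u = v" unfolding eq by (simp add: coset_of_def syndrome_coset_rep)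
qed

lemma coset_adjacent:
  "(\<exists>x\<in>coset_of u. \<exists>y\<in>coset_of v. hamming_weight (x - y) = 1) \<longleftrightarrow> u + v \<in> set points"
proof -
  have minus: "x - y = x + y" for x y :: "f4 ^ 11" by (simp add: vec_eq_iff minus_f4_def)
  show ?thesis
  proof
    assume "\<exists>x\<in>coset_of u. \<exists>y\<in>coset_of v. hamming_weight (x - y) = 1"
    then obtain x y i a where xy: "x \<in> coset_of u" "y \<in> coset_of v" "a \<noteq> 0" "x + y = axis i a"
      unfolding hamming_weight_1_iff minus by blast
    then have "u + v = syn_col i a"
      using syndrome_add[of x y] by (simp add: coset_of_def syndrome_axis)
    then show "u + v \<in> set points" using xy by (auto simp: set_points)
  next
    assume "u + v \<in> set points"
    then obtain i a where ia: "a \<noteq> 0" "u + v = syn_col i a" by (auto simp: set_points)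
    have "syndrome (coset_rep v + axis i a) = v + (u + v)"
      by (simp add: syndrome_add syndrome_coset_rep syndrome_axis ia)
    then have "coset_rep v + axis i a \<in> coset_of u" by (simp add: coset_of_def vec5_char2)
    moreover have "coset_rep v \<in> coset_of v" by (simp add: coset_of_def syndrome_coset_rep)
    moreover have "hamming_weight ((coset_rep v + axis i a) - coset_rep v) = 1"
      using ia unfolding hamming_weight_1_iff by auto
    ultimately show "\<exists>x\<in>coset_of u. \<exists>y\<in>coset_of v. hamming_weight (x - y) = 1" by blast
  qed
qed

interpretation Gam: cayley_copy "set points" coset_of "coset_graph D_minus"
proof
  have verts: "range (\<lambda>x. (+) x ` D_minus) = range coset_of"
    by (auto simp: coset_eq) (metis rangeI syndrome_coset_rep)
  have neq: "coset_of u \<noteq> coset_of v" if "u + v \<in> set points" for u v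
    using that zero_notin_points vec5_add_self inj_coset_of by (metis injD)
  show "coset_graph D_minus = (range coset_of, {{coset_of u, coset_of v} | u v. u + v \<in> set points})"
    unfolding coset_graph_def graph_of_def verts
  proof (intro arg_cong2[where f = Pair] refl equalityI subsetI)
    fix e assume "e \<in> {{u, v} | u v. u \<in> range coset_of \<and> v \<in> range coset_of \<and> u \<noteq> v \<and>
      (\<exists>x\<in>u. \<exists>y\<in>v. hamming_weight (x - y) = 1)}"
    then show "e \<in> {{coset_of u, coset_of v} | u v. u + v \<in> set points}"
      using coset_adjacent by blast
  next
    fix e assume "e \<in> {{coset_of u, coset_of v} | u v. u + v \<in> set points}"
    then obtain u v where e: "e = {coset_of u, coset_of v}" and uv: "u + v \<in> set points" by blast
    show "e \<in> {{u, v} | u v. u \<in> range coset_of \<and> v \<in> range coset_of \<and> u \<noteq> v \<and>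
      (\<exists>x\<in>u. \<exists>y\<in>v. hamming_weight (x - y) = 1)}"
      using e neq[OF uv] coset_adjacent[THEN iffD2, OF uv] by blast
  qed
qed (fact vec5_add_self zero_notin_points points_sidon points_triangle inj_coset_of points_generate)+

section \<open>The linear stabilizer\<close>

declare split_paired_All [simp del] split_paired_Ex [simp del]

text \<open>Two linear maps that permute the points, found by a computer search; they generate a copy of the
  holomorph of the cyclic group of order 9. Each is given by the images of the five axes.\<close>

fun alpha :: "vec5 \<Rightarrow> vec5" where
  "alpha (v, w, x, y, z) =
     on_line ((Fw2, Fw2, Fw2, F1, F0), (Fw, F0, Fw2, Fw, Fw), (F1, Fw2, F0, Fw2, Fw)) v +
     on_line ((F1, F0, F0, F0, F0), (Fw, F0, F0, F0, F0), (Fw2, F0, F0, F0, F0)) w +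
     on_line ((Fw2, F1, Fw2, Fw, Fw2), (F1, Fw2, Fw, F0, Fw2), (Fw, Fw, F1, Fw, F0)) x +
     on_line ((F0, F0, F0, Fw2, F0), (F0, F0, F0, F1, F0), (F0, F0, F0, Fw, F0)) y +
     on_line ((F0, F0, F0, F0, Fw), (F0, F0, F0, F0, Fw2), (F0, F0, F0, F0, F1)) z"

fun delta :: "vec5 \<Rightarrow> vec5" where
  "delta (v, w, x, y, z) =
     on_line ((Fw, F0, F0, F0, F0), (Fw2, F0, F0, F0, F0), (F1, F0, F0, F0, F0)) v +
     on_line ((F1, F0, F1, F1, Fw), (Fw2, F1, F0, F1, F1), (Fw, F1, F1, F0, Fw2)) w +
     on_line ((Fw, F0, Fw2, Fw, Fw), (F1, Fw2, F0, Fw2, Fw), (Fw2, Fw2, Fw2, F1, F0)) x +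
     on_line ((F0, F0, F0, F0, Fw), (F0, F0, F0, F0, Fw2), (F0, F0, F0, F0, F1)) y +
     on_line ((F0, F0, F0, F1, F0), (F0, F0, F0, Fw, F0), (F0, F0, F0, Fw2, F0)) z"

declare alpha.simps [simp del] delta.simps [simp del]

text \<open>A basis over the prime field, grouped by axes. Its first pair lies on the line of
  \<open>base27\<close>, whose image is prescribed when the search starts.\<close>

definition frame :: "(vec5 \<times> vec5) list" where
  "frame =
    [((F1, F0, F0, F0, F0), (Fw, F0, F0, F0, F0)), ((F0, F1, F0, F0, F0), (F0, Fw, F0, F0, F0)),
     ((F0, F0, F1, F0, F0), (F0, F0, Fw, F0, F0)), ((F0, F0, F0, F1, F0), (F0, F0, F0, Fw, F0)),
     ((F0, F0, F0, F0, F1), (F0, F0, F0, F0, Fw))]"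

definition additive :: "(vec5 \<Rightarrow> vec5) \<Rightarrow> bool" where
  "additive f \<longleftrightarrow> (\<forall>x y. f (x + y) = f x + f y)"

text \<open>Additive maps that agree on the ten basis vectors are equal; this turns relations
  between \<open>alpha\<close> and \<open>delta\<close> into finite evaluations.\<close>

lemma additive_eqI:
  assumes f: "additive f" and g: "additive g"
    and "lazy_all (\<lambda>(b, b'). if f b = g b then f b' = g b' else False) frame"
  shows "f = g"
proof
  fix v :: vec5
  have eq: "f b = g b" "f b' = g b'" if "(b, b') \<in> set frame" for b b'
    using assms(3) that by (auto simp: lazy_all_iff split: if_splits)
  have sum: "f (x + y) = g (x + y)" if "f x = g x" "f y = g y" for x y
    using that f g by (simp add: additive_def)
  have zero: "f 0 = g 0"
    using f g by (metis additive_def vec5_add_self)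
  obtain a b c d e where v: "v = (a, b, c, d, e)" by (cases v)
  have line: "f (on_line (b, b', b + b') x) = g (on_line (b, b', b + b') x)"
    if "(b, b') \<in> set frame" for b b' x
    by (cases x) (simp_all add: zero eq[OF that] sum)
  have axis: "(x, F0, F0, F0, F0) = on_line ((F1, F0, F0, F0, F0), (Fw, F0, F0, F0, F0), (F1, F0, F0, F0, F0) + (Fw, F0, F0, F0, F0)) x"
    "(F0, x, F0, F0, F0) = on_line ((F0, F1, F0, F0, F0), (F0, Fw, F0, F0, F0), (F0, F1, F0, F0, F0) + (F0, Fw, F0, F0, F0)) x"
    "(F0, F0, x, F0, F0) = on_line ((F0, F0, F1, F0, F0), (F0, F0, Fw, F0, F0), (F0, F0, F1, F0, F0) + (F0, F0, Fw, F0, F0)) x"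
    "(F0, F0, F0, x, F0) = on_line ((F0, F0, F0, F1, F0), (F0, F0, F0, Fw, F0), (F0, F0, F0, F1, F0) + (F0, F0, F0, Fw, F0)) x"
    "(F0, F0, F0, F0, x) = on_line ((F0, F0, F0, F0, F1), (F0, F0, F0, F0, Fw), (F0, F0, F0, F0, F1) + (F0, F0, F0, F0, Fw)) x" for x
    by (cases x; simp add: vec5_zero zero_f4_def)+
  have "v = (a, F0, F0, F0, F0) + (F0, b, F0, F0, F0) + (F0, F0, c, F0, F0) +
      (F0, F0, F0, d, F0) + (F0, F0, F0, F0, e)"
    by (simp add: v flip: zero_f4_def)
  moreover have "f (a, F0, F0, F0, F0) = g (a, F0, F0, F0, F0)"
    "f (F0, b, F0, F0, F0) = g (F0, b, F0, F0, F0)" "f (F0, F0, c, F0, F0) = g (F0, F0, c, F0, F0)"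
    "f (F0, F0, F0, d, F0) = g (F0, F0, F0, d, F0)" "f (F0, F0, F0, F0, e) = g (F0, F0, F0, F0, e)"
    by (rule line[of "(F1, F0, F0, F0, F0)" "(Fw, F0, F0, F0, F0)", folded axis]
          line[of "(F0, F1, F0, F0, F0)" "(F0, Fw, F0, F0, F0)", folded axis]
          line[of "(F0, F0, F1, F0, F0)" "(F0, F0, Fw, F0, F0)", folded axis]
          line[of "(F0, F0, F0, F1, F0)" "(F0, F0, F0, Fw, F0)", folded axis]
          line[of "(F0, F0, F0, F0, F1)" "(F0, F0, F0, F0, Fw)", folded axis]; simp add: frame_def)+
  ultimately show "f v = g v" by (simp only: sum)
qed

lemma additive_comp: "additive f \<Longrightarrow> additive g \<Longrightarrow> additive (f \<circ> g)"
  by (simp add: additive_def)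

lemma additive_id: "additive id"
  by (simp add: additive_def)

lemma additive_funpow: "additive f \<Longrightarrow> additive (f ^^ n)"
  by (induction n) (simp_all add: additive_comp additive_id flip: id_def)

lemma on_line_add: "r = p + q \<Longrightarrow> on_line (p, q, r) (x + y) = on_line (p, q, r) x + on_line (p, q, r) y"
  by (cases x; cases y) (simp_all add: vec5_char2 zero_f4_def)

lemma additive_alpha: "additive alpha"
  unfolding additive_def split_paired_All add_Pair alpha.simps
  by (simp only: on_line_add add_Pair plus_f4.simps) (simp only: add_ac simp_thms)

lemma additive_delta: "additive delta"
  unfolding additive_def split_paired_All add_Pair delta.simps
  by (simp only: on_line_add add_Pair plus_f4.simps) (simp only: add_ac simp_thms)

lemma alpha_9: "alpha ^^ 9 = id"
  by (rule additive_eqI additive_funpow additive_id additive_alpha)+ code_simp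

lemma delta_6: "delta ^^ 6 = id"
  by (rule additive_eqI additive_funpow additive_id additive_delta)+ code_simp

lemma delta_alpha: "delta \<circ> alpha = alpha ^^ 2 \<circ> delta"
  by (rule additive_eqI additive_comp additive_funpow additive_alpha additive_delta)+ code_simp

lemma alpha_stab: "alpha \<in> Gam.linear_stab"
proof (rule Gam.linear_stabI[OF _ alpha_9])
  have "lazy_all (\<lambda>p. is_point (alpha p)) points" by code_simp
  then show "alpha s \<in> set points" if "s \<in> set points" for s
    using that by (simp add: lazy_all_iff is_point_iff)
qed (use additive_alpha in \<open>simp_all add: additive_def\<close>)

lemma delta_stab: "delta \<in> Gam.linear_stab"
proof (rule Gam.linear_stabI[OF _ delta_6])
  have "lazy_all (\<lambda>p. is_point (delta p)) points" by code_simp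
  then show "delta s \<in> set points" if "s \<in> set points" for s
    using that by (simp add: lazy_all_iff is_point_iff)
qed (use additive_delta in \<open>simp_all add: additive_def\<close>)

section \<open>Normal forms of the products of the two generators\<close>

definition word :: "nat \<Rightarrow> nat \<Rightarrow> vec5 \<Rightarrow> vec5" where
  "word i k = alpha ^^ i \<circ> delta ^^ k"

lemma word_stab: "word i k \<in> Gam.linear_stab"
  unfolding word_def by (intro Gam.comp_linear_stab Gam.funpow_linear_stab alpha_stab delta_stab)

text \<open>Moving a power of \<open>alpha\<close> to the left past \<open>delta ^^ k\<close>
  multiplies its exponent by 2^k.\<close>

lemma word_comp: "word i k \<circ> word j l = word (i + 2 ^ k * j) (k + l)"
proof -
  have 1: "delta \<circ> alpha ^^ j = alpha ^^ (2 * j) \<circ> delta" for j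
  proof (induction j)
    case (Suc j)
    have "delta \<circ> alpha ^^ Suc j = (delta \<circ> alpha) \<circ> alpha ^^ j" by (simp add: comp_assoc)
    also have "\<dots> = alpha ^^ 2 \<circ> (delta \<circ> alpha ^^ j)" by (simp add: delta_alpha comp_assoc)
    also have "\<dots> = alpha ^^ (2 * Suc j) \<circ> delta"
      by (simp only: Suc comp_assoc[symmetric] funpow_add[symmetric] mult_Suc_right)
    finally show ?case .
  qed simp
  have 2: "delta ^^ k \<circ> alpha ^^ j = alpha ^^ (2 ^ k * j) \<circ> delta ^^ k" for k j
  proof (induction k arbitrary: j)
    case (Suc k)
    have "delta ^^ Suc k \<circ> alpha ^^ j = delta ^^ k \<circ> (delta \<circ> alpha ^^ j)"
      by (simp add: funpow_Suc_right comp_assoc del: funpow.simps)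
    also have "\<dots> = (delta ^^ k \<circ> alpha ^^ (2 * j)) \<circ> delta" by (simp only: 1 comp_assoc)
    also have "\<dots> = alpha ^^ (2 ^ Suc k * j) \<circ> delta ^^ Suc k"
      by (simp only: Suc funpow_Suc_right comp_assoc power_Suc mult.assoc mult.left_commute[of _ 2])
    finally show ?case .
  qed simp
  have "word i k \<circ> word j l = alpha ^^ i \<circ> (delta ^^ k \<circ> alpha ^^ j) \<circ> delta ^^ l"
    by (simp add: word_def comp_assoc)
  also have "\<dots> = word (i + 2 ^ k * j) (k + l)"
    by (simp only: 2 word_def funpow_add comp_assoc)
  finally show ?thesis .
qed

lemma funpow_mod_id: "f ^^ n = id \<Longrightarrow> f ^^ (m mod n) = f ^^ m"
  by (rule ext) (metis funpow_mod_eq id_apply)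

lemma word_mod: "word (i mod 9) (k mod 6) = word i k"
  by (simp only: word_def funpow_mod_id[OF alpha_9] funpow_mod_id[OF delta_6])

lemma word_cong: "i mod 9 = j mod 9 \<Longrightarrow> k mod 6 = l mod 6 \<Longrightarrow> word i k = word j l"
  by (metis word_mod)

section \<open>The backtracking search\<close>

fun pair_sums :: "vec5 list \<Rightarrow> vec5 list" where
  "pair_sums [] = []"
| "pair_sums (x # xs) = map ((+) x) xs @ pair_sums xs"

text \<open>Tests a candidate image c against the sums \<open>ys\<close> of images already placed.
  The expected answers \<open>ts\<close> belong to the source side, so they are shared by all
  candidates; the first mismatch ends the test.\<close>

fun matches :: "bool list \<Rightarrow> vec5 list \<Rightarrow> vec5 \<Rightarrow> bool" where
  "matches (t # ts) (y # ys) c = (if is_dist2 (y + c) = t then matches ts ys c else False)"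
| "matches _ _ c = True"

text \<open>\<open>xs\<close> are the vectors placed so far, \<open>ys\<close> their images and
  \<open>bs\<close> the basis pairs still to come. The value is true if every branch that survives
  the tests ends in the identity or in the third power of \<open>delta\<close>. Both orientations of
  a candidate line are tried, and the bound variables \<open>ts\<close>, \<open>ts'\<close>,
  \<open>zs\<close> share the lists between the candidates.\<close>

fun search :: "(vec5 \<times> vec5) list \<Rightarrow> vec5 list \<Rightarrow> vec5 list \<Rightarrow> bool" where
  "search [] xs ys = (if ys = xs then True else ys = map (delta \<circ> delta \<circ> delta) xs)"
| "search ((b, b') # bs) xs ys =
    (\<lambda>ts ts' zs. lazy_all (\<lambda>(c, c', c''). if matches ts zs c then
        (if (if matches ts' zs c' then search bs (b # b' # (b + b') # xs) (c # c' # c'' # ys) else True) then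
         (if matches ts' zs c'' then search bs (b # b' # (b + b') # xs) (c # c'' # c' # ys) else True)
         else False) else True) flags)
     (map (\<lambda>x. is_dist2 (x + b)) (pair_sums xs)) (map (\<lambda>x. is_dist2 (x + b')) (pair_sums xs))
     (pair_sums ys)"

lemma is_dist2_linear:
  assumes A: "A \<in> Gam.linear_stab"
  shows "is_dist2 (A v) \<longleftrightarrow> is_dist2 v"
proof -
  have imp: "is_dist2 (B w)" if B: "B \<in> Gam.linear_stab" and w: "is_dist2 w" for B w
  proof -
    obtain s where s: "w \<noteq> 0" "w \<notin> set points" "s \<in> set points" "w + s \<in> set points"
      using w by (auto simp: is_dist2_iff)
    have "B w \<noteq> 0"
      using s(1) Gam.linear_stabD(2,4)[OF B] by (metis bij_pointE)
    moreover have "B w + B s \<in> set points" "B s \<in> set points" "B w \<notin> set points"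
      using s Gam.linear_stabD(1,3)[OF B] by (metis, blast, blast)
    ultimately show ?thesis unfolding is_dist2_iff by blast
  qed
  have "inv_into UNIV A (A v) = v" using Gam.linear_stabD(2)[OF A] by (simp add: bij_is_inj)
  then have "is_dist2 (A v) \<Longrightarrow> is_dist2 v" using imp[OF Gam.inv_linear_stab[OF A], of "A v"] by simp
  then show ?thesis using imp[OF A, of v] by blast
qed

lemma pair_sums_map: "additive A \<Longrightarrow> pair_sums (map A xs) = map A (pair_sums xs)"
  by (induction xs) (auto simp: additive_def)

text \<open>The pruning is safe: the branch that follows an actual linear automorphism is never
  cut.\<close>

lemma matches_linear:
  assumes A: "A \<in> Gam.linear_stab"
  shows "matches (map (\<lambda>x. is_dist2 (x + b)) zs) (map A zs) (A b)"
  by (induction zs) (simp_all add: is_dist2_linear[OF A] flip: Gam.linear_stabD(1)[OF A])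

lemma additive_linear_stab: "A \<in> Gam.linear_stab \<Longrightarrow> additive A"
  by (simp add: additive_def Gam.linear_stabD(1))

text \<open>The search tree branches over all images of the lines of a frame that are compatible with
  the distance-2 relation on the points already placed.\<close>

lemma search_sound:
  assumes A: "A \<in> Gam.linear_stab" and "search bs xs (map A xs)"
    and "\<And>b b'. (b, b') \<in> set bs \<Longrightarrow> b \<in> set points \<and> b' \<in> set points \<and> b + b' \<in> set points"
  shows "\<exists>B\<in>{id, delta \<circ> delta \<circ> delta}. \<forall>x\<in>set xs \<union> fst ` set bs \<union> snd ` set bs. A x = B x"
  using assms(2,3)
proof (induction bs arbitrary: xs)
  case Nil
  then have "map A xs = map id xs \<or> map A xs = map (delta \<circ> delta \<circ> delta) xs"
    by (simp split: if_splits)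
  then show ?case unfolding map_eq_conv by auto
next
  case (Cons p bs)
  obtain b b' where p: "p = (b, b')" by (cases p)
  let ?c = "A b" and ?c' = "A b'" and ?ts = "\<lambda>b. map (\<lambda>x. is_dist2 (x + b)) (pair_sums xs)"
    and ?zs = "map A (pair_sums xs)"
  note add = Gam.linear_stabD(1)[OF A]
  have S: "b \<in> set points" "b' \<in> set points" "b + b' \<in> set points" using Cons.prems(2)[of b b'] p by auto
  \<comment> \<open>The image of a line is a line, so the images of the new basis pair occur among
    the branches in one of the two orientations.\<close>
  then have "(?c, ?c', ?c + ?c') \<in> set flags \<or> (?c, ?c + ?c', ?c') \<in> set flags"
    using Gam.linear_stabD(3)[OF A] add by (intro points_flag) (simp_all flip: add)
  moreover have "matches (?ts b) ?zs ?c" "matches (?ts b') ?zs ?c'"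
    by (rule matches_linear[OF A])+
  moreover have "\<forall>(c, c', c'')\<in>set flags. matches (?ts b) ?zs c \<longrightarrow>
      (matches (?ts b') ?zs c' \<longrightarrow> search bs (b # b' # (b + b') # xs) (c # c' # c'' # map A xs)) \<and>
      (matches (?ts b') ?zs c'' \<longrightarrow> search bs (b # b' # (b + b') # xs) (c # c'' # c' # map A xs))"
    using Cons.prems(1) unfolding p search.simps lazy_all_iff pair_sums_map[OF additive_linear_stab[OF A]]
    by (fastforce split: if_splits)
  ultimately have "search bs (b # b' # (b + b') # xs) (?c # ?c' # (?c + ?c') # map A xs)" by blast
  then have "search bs (b # b' # (b + b') # xs) (map A (b # b' # (b + b') # xs))" by (simp add: add)
  moreover have "x \<in> set points \<and> y \<in> set points \<and> x + y \<in> set points" if "(x, y) \<in> set bs" for x y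
    using Cons.prems(2) that by (meson list.set_intros(2))
  ultimately obtain B where B: "B \<in> {id, delta \<circ> delta \<circ> delta}"
    "\<forall>x\<in>set (b # b' # (b + b') # xs) \<union> fst ` set bs \<union> snd ` set bs. A x = B x"
    using Cons.IH by blast
  then have "\<forall>x\<in>set xs \<union> fst ` set (p # bs) \<union> snd ` set (p # bs). A x = B x" using p by auto
  then show ?case using B(1) by blast
qed

text \<open>Representatives of the two orbits of points, named after the orbit lengths.\<close>

abbreviation base27 :: vec5 where "base27 \<equiv> (F1, F0, F0, F0, F0)"
abbreviation base6 :: vec5 where "base6 \<equiv> (F0, F0, F0, F1, F0)"

text \<open>The zero vector is included so that the pair sums also contain the placed vectors
  themselves, and not only sums of two of them.\<close>

definition first_line :: "vec5 list" where
  "first_line = [base27, (Fw, F0, F0, F0, F0), (Fw2, F0, F0, F0, F0), (F0, F0, F0, F0, F0)]"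

text \<open>The third power of \<open>delta\<close> fixes this line pointwise, so only this run can
  end in an accepted leaf. The three runs below alter the line and hold because all their branches
  are cut.\<close>

lemma search_run_1:
  "search (tl frame) first_line [base27, (Fw, F0, F0, F0, F0), (Fw2, F0, F0, F0, F0), (F0, F0, F0, F0, F0)]"
  by code_simp

lemma search_run_2:
  "search (tl frame) first_line [base27, (Fw2, F0, F0, F0, F0), (Fw, F0, F0, F0, F0), (F0, F0, F0, F0, F0)]"
  by code_simp

lemma search_run_3:
  "search (tl frame) first_line [base6, (F0, F0, F0, Fw, F0), (F0, F0, F0, Fw2, F0), (F0, F0, F0, F0, F0)]"
  by code_simp

lemma search_run_4:
  "search (tl frame) first_line [base6, (F0, F0, F0, Fw2, F0), (F0, F0, F0, Fw, F0), (F0, F0, F0, F0, F0)]"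
  by code_simp

lemma linear_stab_base:
  assumes A: "A \<in> Gam.linear_stab" and base: "A base27 \<in> {base27, base6}"
  shows "A = word 0 0 \<or> A = word 0 3"
proof -
  let ?p = base27 and ?q = "(Fw, F0, F0, F0, F0)"
  note add = Gam.linear_stabD(1)[OF A]
  have pts: "b \<in> set points \<and> b' \<in> set points \<and> b + b' \<in> set points" if "(b, b') \<in> set frame" for b b'
  proof -
    have "lazy_all (\<lambda>(b, b'). if is_point b then if is_point b' then is_point (b + b') else False else False) frame"
      by code_simp
    then show ?thesis using that by (force simp: lazy_all_iff is_point_iff split: if_splits)
  qed
  have "(A ?p, A ?q, A ?p + A ?q) \<in> set flags \<or> (A ?p, A ?p + A ?q, A ?q) \<in> set flags"
    using pts[of ?p ?q] Gam.linear_stabD(3)[OF A] by (intro points_flag) (simp_all add: frame_def flip: add)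
  moreover have flags: "lazy_all (\<lambda>(c, c', c'').
      if c = ?p then (if c' = (Fw, F0, F0, F0, F0) then c'' = (Fw2, F0, F0, F0, F0) else False)
      else if c = base6 then (if c' = (F0, F0, F0, Fw, F0) then c'' = (F0, F0, F0, Fw2, F0) else False)
      else True) flags"
    by code_simp
  have "c = ?p \<longrightarrow> c' = (Fw, F0, F0, F0, F0) \<and> c'' = (Fw2, F0, F0, F0, F0)"
    "c = base6 \<longrightarrow> c' = (F0, F0, F0, Fw, F0) \<and> c'' = (F0, F0, F0, Fw2, F0)"
    if "(c, c', c'') \<in> set flags" for c c' c''
    using bspec[OF flags[unfolded lazy_all_iff] that] by (auto split: if_splits)
  ultimately have cases: "A ?p = ?p \<and> A ?q = (Fw, F0, F0, F0, F0) \<or>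
    A ?p = ?p \<and> A ?q = (Fw2, F0, F0, F0, F0) \<or>
    A ?p = base6 \<and> A ?q = (F0, F0, F0, Fw, F0) \<or> A ?p = base6 \<and> A ?q = (F0, F0, F0, Fw2, F0)"
    using base by blast
  have map: "map A first_line = [A ?p, A ?q, A ?p + A ?q, (F0, F0, F0, F0, F0)]"
    using Gam.linear_stabD(4)[OF A] add[of ?p ?q] by (simp add: first_line_def vec5_zero zero_f4_def)
  have "search (tl frame) first_line (map A first_line)"
    unfolding map using cases
    by (elim disjE conjE)
      (simp_all add: search_run_1 search_run_2 search_run_3 search_run_4 zero_f4_def)
  from search_sound[OF A this] obtain B where B: "B \<in> {id, delta \<circ> delta \<circ> delta}"
    "\<forall>x\<in>set first_line \<union> fst ` set (tl frame) \<union> snd ` set (tl frame). A x = B x"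
    using pts by (metis list.set_sel(2) frame_def list.distinct(1))
  have "additive B" using B(1) additive_id additive_comp additive_delta by auto
  have "A b = B b \<and> A b' = B b'" if "(b, b') \<in> set frame" for b b'
    using that B(2) by (auto simp: frame_def first_line_def)
  then have "A = B"
    by (intro additive_eqI additive_linear_stab A \<open>additive B\<close>) (auto simp: lazy_all_iff)
  moreover have "word 0 0 = id" "word 0 3 = delta \<circ> delta \<circ> delta"
    by (simp_all add: word_def numeral_3_eq_3 id_def comp_def)
  ultimately show ?thesis using B(1) by auto
qed

text \<open>Short exponent ranges suffice, because \<open>delta ^^ 3\<close> fixes
  \<open>base27\<close> and \<open>alpha ^^ 3\<close> fixes \<open>base6\<close>: 9 * 3 words give
  the long orbit, 3 * 2 the short one.\<close>

lemma points_reached: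
  assumes "s \<in> set points"
  shows "\<exists>i k. s = word i k base27 \<or> s = word i k base6"
proof -
  have "lazy_all (\<lambda>s.
      if lazy_ex (\<lambda>i. lazy_ex (\<lambda>k. word i k base27 = s) [0, 1, 2]) [0, 1, 2, 3, 4, 5, 6, 7, 8]
      then True else lazy_ex (\<lambda>i. lazy_ex (\<lambda>k. word i k base6 = s) [0, 1]) [0, 1, 2]) points"
    by code_simp
  then have "lazy_ex (\<lambda>i. lazy_ex (\<lambda>k. word i k base27 = s) [0, 1, 2]) [0, 1, 2, 3, 4, 5, 6, 7, 8] \<or>
      lazy_ex (\<lambda>i. lazy_ex (\<lambda>k. word i k base6 = s) [0, 1]) [0, 1, 2]"
    using assms unfolding lazy_all_iff by (meson if_bool_eq_disj)
  then show ?thesis unfolding lazy_ex_iff by blast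
qed

lemma word_zero: "word 0 0 = id"
  by (simp add: word_def id_def comp_def)

lemma word_left_inverse: "\<exists>j l. word j l \<circ> word i k = id"
proof -
  have "word (2 ^ (5 * k) * 8 * i) (5 * k) \<circ> word i k = word (9 * (2 ^ (5 * k) * i)) (6 * k)"
    by (simp add: word_comp mult.commute)
  also have "\<dots> = word 0 0" by (rule word_cong) simp_all
  finally show ?thesis using word_zero by metis
qed

text \<open>Some word takes \<open>base27\<close> or \<open>base6\<close> to the image of
  \<open>base27\<close> under A. Undoing it leaves one of the maps already determined by the
  search.\<close>

lemma linear_stab_words:
  assumes A: "A \<in> Gam.linear_stab"
  shows "\<exists>i k. A = word i k"
proof -
  have "base27 \<in> set points" unfolding is_point_iff[symmetric] by code_simp
  then have "A base27 \<in> set points" by (simp add: Gam.linear_stabD(3)[OF A])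
  then obtain i k c where c: "c \<in> {base27, base6}" and Ac: "A base27 = word i k c"
    using points_reached by blast
  obtain j l where inv: "word j l \<circ> word i k = id" using word_left_inverse by blast
  then have inv1: "word j l (word i k x) = x" for x by (metis comp_apply id_apply)
  have inv2: "word i k (word j l x) = x" for x
  proof -
    obtain y where "x = word i k y"
      using Gam.linear_stabD(2)[OF word_stab[of i k]] by (metis bij_pointE)
    then show ?thesis by (simp add: inv1)
  qed
  have "(word j l \<circ> A) base27 \<in> {base27, base6}" using c by (simp add: Ac inv1)
  then have "word j l \<circ> A = word 0 0 \<or> word j l \<circ> A = word 0 3"
    by (intro linear_stab_base Gam.comp_linear_stab word_stab A)
  moreover have "A = word i k \<circ> (word j l \<circ> A)" by (simp add: fun_eq_iff inv2)
  ultimately have "A = word i k \<circ> word 0 0 \<or> A = word i k \<circ> word 0 3" by metis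
  then show ?thesis by (auto simp: word_comp)
qed

lemma card_linear_stab: "card Gam.linear_stab = 54"
proof -
  let ?f = "\<lambda>(i, k). word i k" and ?v = "(F0, F1, F0, F0, F0)"
    and ?X = "List.product [0..<9] [0..<6]"
  have X: "set ?X = {..<9} \<times> {..<6}" by (auto simp: set_product)
  have "Gam.linear_stab = ?f ` ({..<9} \<times> {..<6})"
  proof (intro equalityI subsetI)
    fix A assume "A \<in> Gam.linear_stab"
    then obtain i k where "A = word i k" using linear_stab_words by blast
    then have "A = ?f (i mod 9, k mod 6)" by (simp add: word_mod)
    then show "A \<in> ?f ` ({..<9} \<times> {..<6})" by (rule image_eqI) simp
  qed (auto simp: word_stab)
  \<comment> \<open>The image of \<open>base27\<close> alone cannot separate a word from its product
    with \<open>delta ^^ 3\<close>; the image of a vector on the second axis does.\<close>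
  moreover have "distinct (map (\<lambda>(i, k). (word i k base27, word i k ?v)) ?X)" by code_simp
  then have "inj_on (\<lambda>(i, k). (word i k base27, word i k ?v)) ({..<9} \<times> {..<6})"
    unfolding distinct_map X by blast
  then have "inj_on ?f ({..<9} \<times> {..<6})"
    by (auto simp: inj_on_def)
  ultimately show ?thesis by (simp add: card_image card_cartesian_product)
qed

section \<open>The two orbits of points: the lines of coordinates 4 and 8, and the rest\<close>

definition special :: "vec5 list" where
  "special = [(F0, F0, F0, F1, F0), (F0, F0, F0, Fw, F0), (F0, F0, F0, Fw2, F0),
    (F0, F0, F0, F0, F1), (F0, F0, F0, F0, Fw), (F0, F0, F0, F0, Fw2)]"

lemma word_special: "word i k s \<in> set special \<longleftrightarrow> s \<in> set special"
proof -
  have "lazy_all (\<lambda>s. lazy_ex (\<lambda>t. t = alpha s) special) special"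
    "lazy_all (\<lambda>s. lazy_ex (\<lambda>t. t = delta s) special) special" by code_simp+
  then have cl: "alpha s \<in> set special" "delta s \<in> set special" if "s \<in> set special" for s
    using that unfolding lazy_all_iff lazy_ex_iff by blast+
  then have "(delta ^^ k) s \<in> set special" if "s \<in> set special" for s k using that by (induction k) auto
  moreover have "(alpha ^^ i) s \<in> set special" if "s \<in> set special" for s i
    using that cl by (induction i) auto
  ultimately have cl: "word i k s \<in> set special" if "s \<in> set special" for s i k
    using that by (simp add: word_def)
  obtain j l where "word j l \<circ> word i k = id" using word_left_inverse by blast
  then have "word j l (word i k s) = s" by (metis comp_apply id_apply)
  then show ?thesis using cl by metis
qed

text \<open>Each orbit stays on its side of an invariant partition of the points, and together the
  orbits cover all points; hence both inclusions are equalities.\<close>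

lemma orbit_special: "{A base6 | A. A \<in> Gam.linear_stab} = set special"
  and orbit_general: "{A base27 | A. A \<in> Gam.linear_stab} = set points - set special"
proof -
  have "lazy_all is_point special" "is_point base27" by code_simp+
  then have sp: "set special \<subseteq> set points" "base27 \<in> set points" by (auto simp: lazy_all_iff is_point_iff)
  have b: "base6 \<in> set special" "base27 \<notin> set special" by (auto simp: special_def)
  have 1: "{A base6 | A. A \<in> Gam.linear_stab} \<subseteq> set special"
    using linear_stab_words word_special b(1) by blast
  have 2: "{A base27 | A. A \<in> Gam.linear_stab} \<subseteq> set points - set special"
    using linear_stab_words word_special b(2) Gam.linear_stabD(3) sp(2) by blast
  have 3: "set points \<subseteq> {A base6 | A. A \<in> Gam.linear_stab} \<union> {A base27 | A. A \<in> Gam.linear_stab}"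
    using points_reached word_stab by blast
  have "X = U \<and> Y = W - U" if "X \<subseteq> U" "Y \<subseteq> W - U" "W \<subseteq> X \<union> Y" "U \<subseteq> W" for X Y U W :: "vec5 set"
    using that by blast
  from this[OF 1 2 3 sp(1)]
  show "{A base6 | A. A \<in> Gam.linear_stab} = set special"
    "{A base27 | A. A \<in> Gam.linear_stab} = set points - set special" by blast+
qed

lemma card_special: "card (set special) = 6"
  by (simp add: special_def)

lemma card_points: "card (set points) = 33"
proof -
  have "distinct points" "length points = 33" by code_simp+
  then show ?thesis using distinct_card by metis
qed

section \<open>Fixed subgraphs\<close>

definition fixed_graph :: "(vec5 \<Rightarrow> vec5) \<Rightarrow> vec5 graph" where
  "fixed_graph A = Gam.cayley_on {v. A v = v}"

lemma fixed_graph_eqI: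
  assumes "all_vec5 (\<lambda>v. (A v = v) = lazy_ex (\<lambda>w. w = v) ws)"
  shows "fixed_graph A = graph_of (set ws) (\<lambda>x y. x + y \<in> set points)"
proof -
  have "A v = v \<longleftrightarrow> v \<in> set ws" for v using all_vec5D[OF assms, of v] by (simp add: lazy_ex_iff)
  then show ?thesis by (simp add: fixed_graph_def Gam.cayley_on_def)
qed

text \<open>The constant \<open>c\<close> treats complete and edge-free graphs at once.\<close>

lemma fixed_graph_isomorphic_list:
  assumes A: "all_vec5 (\<lambda>v. (A v = v) = lazy_ex (\<lambda>w. w = v) ws)" and dist: "distinct ws"
    and adj: "lazy_all (\<lambda>x. lazy_all (\<lambda>y. if x = y then True else is_point (x + y) = c) ws) ws"
  shows "graph_isomorphic (fixed_graph A) (graph_of {..<length ws} (\<lambda>_ _. c))"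
proof (rule graph_isomorphic_sym)
  have "graph_isomorphism (graph_of {..<length ws} (\<lambda>_ _. c)) (fixed_graph A) ((!) ws)"
    unfolding fixed_graph_eqI[OF A]
  proof (rule graph_isomorphism_graph_of)
    show "bij_betw ((!) ws) {..<length ws} (set ws)" by (rule bij_betw_nth[OF dist]) auto
    show "c \<longleftrightarrow> ws ! i + ws ! j \<in> set points"
      if "i \<in> {..<length ws}" "j \<in> {..<length ws}" "i \<noteq> j" for i j
    proof -
      have "ws ! i \<noteq> ws ! j" using that dist by (simp add: nth_eq_iff_index_eq)
      moreover have "ws ! i \<in> set ws" "ws ! j \<in> set ws" using that by simp_all
      ultimately show ?thesis using adj unfolding lazy_all_iff is_point_iff by (metis (full_types))
    qed
  qed (simp_all add: add.commute)
  then show "graph_isomorphic (graph_of {..<length ws} (\<lambda>_ _. c)) (fixed_graph A)"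
    by (auto simp: graph_isomorphic_def)
qed

lemma fixed_alpha: "graph_isomorphic (fixed_graph (word 1 0)) (edgeless_graph 1)"
proof -
  have "graph_isomorphic (fixed_graph (word 1 0)) (graph_of {..<length [(F0, F0, F0, F0, F0)]} (\<lambda>_ _. False))"
    by (rule fixed_graph_isomorphic_list) code_simp+
  then show ?thesis by (simp add: edgeless_graph_def)
qed

lemma fixed_delta:
  assumes "k = 1 \<or> k = 5"
  shows "graph_isomorphic (fixed_graph (word 0 k)) (edgeless_graph 2)"
proof -
  let ?ws = "[(F0, F0, F0, F0, F0), (F0, Fw, Fw2, Fw, Fw)]"
  have "graph_isomorphic (fixed_graph (word 0 1)) (graph_of {..<length ?ws} (\<lambda>_ _. False))"
    "graph_isomorphic (fixed_graph (word 0 5)) (graph_of {..<length ?ws} (\<lambda>_ _. False))"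
    by (rule fixed_graph_isomorphic_list; code_simp)+
  then show ?thesis using assms by (auto simp: edgeless_graph_def numeral_2_eq_2)
qed

lemma fixed_delta_2:
  assumes "k = 2 \<or> k = 4"
  shows "graph_isomorphic (fixed_graph (word 0 k)) (edgeless_graph 4)"
proof -
  let ?ws = "[(F0, F0, F0, F0, F0), (F0, Fw2, F1, F1, F1), (F0, Fw, Fw2, Fw, Fw), (F0, F1, Fw, Fw2, Fw2)]"
  have "graph_isomorphic (fixed_graph (word 0 2)) (graph_of {..<length ?ws} (\<lambda>_ _. False))"
    "graph_isomorphic (fixed_graph (word 0 4)) (graph_of {..<length ?ws} (\<lambda>_ _. False))"
    by (rule fixed_graph_isomorphic_list; code_simp)+
  then show ?thesis using assms by (auto simp: edgeless_graph_def eval_nat_numeral)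
qed

lemma fixed_alpha_delta_2:
  assumes "k = 2 \<or> k = 4"
  shows "graph_isomorphic (fixed_graph (word 1 k)) (complete_graph 4)"
proof -
  let ?ws = "[(F0, F0, F0, F0, F0), (F0, F0, F0, F1, F0), (F0, F0, F0, Fw, F0), (F0, F0, F0, Fw2, F0)]"
  let ?ws' = "[(F0, F0, F0, F0, F0), (F0, F0, F0, F0, F1), (F0, F0, F0, F0, Fw), (F0, F0, F0, F0, Fw2)]"
  have "graph_isomorphic (fixed_graph (word 1 2)) (graph_of {..<length ?ws} (\<lambda>_ _. True))"
    "graph_isomorphic (fixed_graph (word 1 4)) (graph_of {..<length ?ws'} (\<lambda>_ _. True))"
    by (rule fixed_graph_isomorphic_list; code_simp)+
  then show ?thesis using assms by (auto simp: complete_graph_def eval_nat_numeral)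
qed

text \<open>The fixed space is spanned by the last two axes over \<open>f4\<close>. A vector in it
  is a point exactly when one of the two entries vanishes and the other does not, which is adjacency
  in the Hamming graph.\<close>

lemma fixed_alpha_3: "graph_isomorphic (fixed_graph (word 3 0)) (hamming_graph :: (f4 ^ 2) graph)"
proof (rule graph_isomorphic_sym)
  let ?f = "\<lambda>v :: f4 ^ 2. (F0, F0, F0, v $ 1, v $ 2)"
  have "all_vec5 (\<lambda>v. (word 3 0 v = v) =
      (case v of (a, b, c, d, e) \<Rightarrow> if a = F0 then if b = F0 then c = F0 else False else False))"
    by code_simp
  from all_vec5D[OF this]
  have fx: "word 3 0 (a, b, c, d, e) = (a, b, c, d, e) \<longleftrightarrow> a = F0 \<and> b = F0 \<and> c = F0" for a b c d e
    by simp
  have "graph_isomorphism (hamming_graph :: (f4 ^ 2) graph) (fixed_graph (word 3 0)) ?f"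
    unfolding hamming_graph_def fixed_graph_def Gam.cayley_on_def
  proof (rule graph_isomorphism_graph_of)
    show "bij_betw ?f UNIV {v. word 3 0 v = v}"
    proof (rule bij_betw_imageI)
      show "inj ?f" by (auto simp: inj_def vec_eq_iff forall_2)
      show "range ?f = {v. word 3 0 v = v}"
      proof (intro equalityI subsetI)
        fix v assume v: "v \<in> {v. word 3 0 v = v}"
        obtain a b c d e where "v = (a, b, c, d, e)" by (cases v)
        then have "v = ?f (vector [d, e])" using v fx by simp
        then show "v \<in> range ?f" by blast
      qed (use fx in auto)
    qed
    show "card {i. x $ i \<noteq> y $ i} = 1 \<longleftrightarrow> ?f x + ?f y \<in> set points" for x y :: "f4 ^ 2"
    proof -
      have "is_point (F0, F0, F0, a + b, c + d) \<longleftrightarrow> (a = b) \<noteq> (c = d)" for a b c d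
        by (cases a; cases b; cases c; cases d; simp add: is_point.simps zero_f4_def)
      then have "?f x + ?f y \<in> set points \<longleftrightarrow> (x $ 1 = y $ 1) \<noteq> (x $ 2 = y $ 2)"
        unfolding is_point_iff[symmetric] by (simp add: zero_f4_def)
      moreover have "{i. x $ i \<noteq> y $ i} =
        (if x $ 1 = y $ 1 then {} else {1}) \<union> (if x $ 2 = y $ 2 then {} else {2})"
        unfolding set_eq_iff forall_2 by auto
      ultimately show ?thesis by auto
    qed
  qed (simp_all add: add.commute eq_commute)
  then show "graph_isomorphic (hamming_graph :: (f4 ^ 2) graph) (fixed_graph (word 3 0))"
    by (auto simp: graph_isomorphic_def)
qed

text \<open>The only points in the fixed space, which has 32 elements, are those of the line of
  \<open>base27\<close>. With 0 they form the subgroup \<open>ls\<close>; its cosets, represented by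
  \<open>ts\<close>, are the eight cliques.\<close>

lemma fixed_delta_3:
  "graph_isomorphic (fixed_graph (word 0 3)) (disjoint_copies 8 (complete_graph 4))"
proof (rule graph_isomorphic_sym)
  define ts :: "vec5 list" where "ts = [(F0, F0, F0, F0, F0), (F0, Fw, Fw2, F1, F0), (F0, F0, F0, Fw, F1),
    (F0, Fw, Fw2, Fw2, F1), (F0, Fw, Fw2, Fw, Fw), (F0, F0, F0, Fw2, Fw), (F0, Fw, Fw2, F0, Fw2),
    (F0, F0, F0, F1, Fw2)]"
  define ls :: "vec5 list" where "ls = [(F0, F0, F0, F0, F0), (F1, F0, F0, F0, F0), (Fw, F0, F0, F0, F0),
    (Fw2, F0, F0, F0, F0)]"
  let ?f = "\<lambda>(i, j). ts ! i + ls ! j" and ?X = "List.product [0..<8] [0..<4]"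
  have X: "set ?X = {..<8} \<times> {..<4}" by (auto simp: set_product)
  have dist: "distinct (map ?f ?X)" unfolding ts_def ls_def by code_simp
  have fx: "all_vec5 (\<lambda>v. (word 0 3 v = v) = lazy_ex (\<lambda>w. w = v) (map ?f ?X))"
    unfolding ts_def ls_def by code_simp
  have adj: "lazy_all (\<lambda>(i, j). lazy_all (\<lambda>(i', j'). is_point (?f (i, j) + ?f (i', j')) =
      (if i = i' then j \<noteq> j' else False)) ?X) ?X"
    unfolding ts_def ls_def by code_simp
  have "graph_isomorphism (disjoint_copies 8 (complete_graph 4)) (fixed_graph (word 0 3)) ?f"
    unfolding disjoint_copies_def fixed_graph_eqI[OF fx]
  proof (rule graph_isomorphism_graph_of)
    have "inj_on ?f ({..<8} \<times> {..<4})" using dist unfolding distinct_map X by blast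
    then show "bij_betw ?f ({..<8} \<times> verts (complete_graph 4)) (set (map ?f ?X))"
      unfolding set_map X complete_graph_def graph_of_def by (simp add: bij_betw_def)
    show "(case u of (i, u) \<Rightarrow> \<lambda>(j, v). i = j \<and> {u, v} \<in> edges (complete_graph 4)) v \<longleftrightarrow>
        ?f u + ?f v \<in> set points"
      if "u \<in> {..<8} \<times> verts (complete_graph 4)" "v \<in> {..<8} \<times> verts (complete_graph 4)" for u v
    proof -
      obtain i j i' j' where uv: "u = (i, j)" "v = (i', j')" by (cases u, cases v)
      have mem: "(i, j) \<in> set ?X" "(i', j') \<in> set ?X"
        using that unfolding X uv complete_graph_def graph_of_def by simp_all
      have "is_point (?f (i, j) + ?f (i', j')) = (if i = i' then j \<noteq> j' else False)"
        using bspec[OF bspec[OF adj[unfolded lazy_all_iff] mem(1), unfolded prod.case lazy_all_iff] mem(2)]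
        by simp
      moreover have "{j, j'} \<in> edges (complete_graph 4) \<longleftrightarrow> j \<noteq> j'"
        using mem unfolding X by (auto simp: complete_graph_def graph_of_def doubleton_eq_iff)
      ultimately show ?thesis unfolding uv is_point_iff by simp
    qed
  qed (auto simp: add.commute insert_commute)
  then show "graph_isomorphic (disjoint_copies 8 (complete_graph 4)) (fixed_graph (word 0 3))"
    by (auto simp: graph_isomorphic_def)
qed

text \<open>The null graph does not occur here since a linear map fixes 0. The trivial case records
  \<open>A = id\<close>, from which the isomorphism with the whole graph is obtained later.\<close>

definition fixed_class :: "(vec5 \<Rightarrow> vec5) \<Rightarrow> nat \<Rightarrow> bool" where
  "fixed_class A n \<longleftrightarrow> (\<forall>m. A ^^ m = id \<longleftrightarrow> n dvd m) \<and>
    (A = id \<and> n = 1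
     \<or> graph_isomorphic (fixed_graph A) (disjoint_copies 8 (complete_graph 4)) \<and> n = 2
     \<or> graph_isomorphic (fixed_graph A) (edgeless_graph 4) \<and> n = 3
     \<or> graph_isomorphic (fixed_graph A) (hamming_graph :: (f4 ^ 2) graph) \<and> n = 3
     \<or> graph_isomorphic (fixed_graph A) (edgeless_graph 2) \<and> n = 6
     \<or> graph_isomorphic (fixed_graph A) (edgeless_graph 1) \<and> n = 9
     \<or> graph_isomorphic (fixed_graph A) (complete_graph 4) \<and> n = 9)"

lemma fixed_class_conjugate:
  assumes B: "B \<in> Gam.linear_stab" and conj: "R \<circ> B = B \<circ> A" and R: "fixed_class R n"
  shows "fixed_class A n"
proof -
  have iso: "graph_isomorphic (fixed_graph R) X \<Longrightarrow> graph_isomorphic (fixed_graph A) X" for X :: "'x graph"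
    using Gam.cayley_on_fixed_conjugate(1)[OF B conj] graph_isomorphic_trans
    unfolding fixed_graph_def by blast
  have ord: "A ^^ m = id \<longleftrightarrow> n dvd m" for m
    using Gam.cayley_on_fixed_conjugate(2)[OF B conj] R by (simp add: fixed_class_def)
  have "A = id" if "n = 1" using that ord[of 1] by simp
  then show ?thesis
    using R unfolding fixed_class_def by (elim conjE disjE) (simp_all add: ord iso)
qed

text \<open>The order divides n but none of the numbers in \<open>M\<close>; taking for
  \<open>M\<close> the maximal proper divisors of n leaves only n itself.\<close>

lemma word_order:
  assumes n: "word r k ^^ n = id" and prime: "\<And>q. q \<in> M \<Longrightarrow> word r k ^^ q \<noteq> id"
    and div: "\<And>m. m dvd n \<Longrightarrow> (\<forall>q\<in>M. \<not> m dvd q) \<Longrightarrow> m = n"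
  shows "word r k ^^ m = id \<longleftrightarrow> n dvd m"
proof -
  obtain n' where n': "\<And>m. word r k ^^ m = id \<longleftrightarrow> n' dvd m"
    using Gam.ex_order_linear[OF word_stab] by blast
  then have "n' = n" using n prime div by metis
  then show ?thesis using n' by simp
qed

lemma additive_word: "additive (word i k)"
  by (rule additive_linear_stab) (rule word_stab)

lemma word_pow_id:
  "lazy_all (\<lambda>(r, k, n). lazy_all (\<lambda>(b, b'). if (word r k ^^ n) b = b then (word r k ^^ n) b' = b' else False) frame)
    [(1, 0, 9), (3, 0, 3), (0, 1, 6), (0, 5, 6), (0, 2, 3), (0, 4, 3), (1, 2, 9), (1, 4, 9), (0, 3, 2)]"
  by code_simp

lemma word_pow_not_id:
  "lazy_all (\<lambda>(r, k, n). (word r k ^^ n) (F0, F1, F0, F0, F0) \<noteq> (F0, F1, F0, F0, F0))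
    [(1, 0, 3), (3, 0, 1), (0, 1, 2), (0, 1, 3), (0, 5, 2), (0, 5, 3), (0, 2, 1), (0, 4, 1), (1, 2, 3),
     (1, 4, 3), (0, 3, 1)]"
  by code_simp

lemma dvd_9_unique: "m dvd (9::nat) \<Longrightarrow> \<not> m dvd 3 \<Longrightarrow> m = 9"
  and dvd_6_unique: "m dvd (6::nat) \<Longrightarrow> \<not> m dvd 2 \<Longrightarrow> \<not> m dvd 3 \<Longrightarrow> m = 6"
  and dvd_3_unique: "m dvd (3::nat) \<Longrightarrow> \<not> m dvd 1 \<Longrightarrow> m = 3"
  and dvd_2_unique: "m dvd (2::nat) \<Longrightarrow> \<not> m dvd 1 \<Longrightarrow> m = 2"
proof -
  have le: "m dvd n \<Longrightarrow> 0 < n \<Longrightarrow> m \<le> n \<and> m \<noteq> 0" for n :: nat using dvd_imp_le by auto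
  show "m dvd (9::nat) \<Longrightarrow> \<not> m dvd 3 \<Longrightarrow> m = 9"
    using le[of 9] by (cases "m \<in> {1, 2, 3, 4, 5, 6, 7, 8}") auto
  show "m dvd (6::nat) \<Longrightarrow> \<not> m dvd 2 \<Longrightarrow> \<not> m dvd 3 \<Longrightarrow> m = 6"
    using le[of 6] by (cases "m \<in> {1, 2, 3, 4, 5}") auto
  show "m dvd (3::nat) \<Longrightarrow> \<not> m dvd 1 \<Longrightarrow> m = 3"
    using le[of 3] by (cases "m \<in> {1, 2}") auto
  show "m dvd (2::nat) \<Longrightarrow> \<not> m dvd 1 \<Longrightarrow> m = 2"
    using le[of 2] by (cases "m \<in> {1}") auto
qed

lemma fixed_class_representatives:
  "fixed_class (word 0 0) 1" "fixed_class (word 1 0) 9" "fixed_class (word 3 0) 3"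
  "fixed_class (word 0 1) 6" "fixed_class (word 0 5) 6" "fixed_class (word 0 3) 2"
  "fixed_class (word 0 2) 3" "fixed_class (word 0 4) 3" "fixed_class (word 1 2) 9" "fixed_class (word 1 4) 9"
proof -
  have id: "word r k ^^ n = id" if "(r, k, n) \<in> set [(1, 0, 9), (3, 0, 3), (0, 1, 6), (0, 5, 6), (0, 2, 3),
    (0, 4, 3), (1, 2, 9), (1, 4, 9), (0, 3, 2)]" for r k n
    by (rule additive_eqI[OF additive_funpow[OF additive_word] additive_id])
      (use bspec[OF word_pow_id[unfolded lazy_all_iff[of "\<lambda>(r, k, n). _ r k n"]] that] in
        \<open>simp only: prod.case id_apply\<close>)
  have nid: "word r k ^^ n \<noteq> id" if "(r, k, n) \<in> set [(1, 0, 3), (3, 0, 1), (0, 1, 2), (0, 1, 3), (0, 5, 2),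
    (0, 5, 3), (0, 2, 1), (0, 4, 1), (1, 2, 3), (1, 4, 3), (0, 3, 1)]" for r k n
    using bspec[OF word_pow_not_id[unfolded lazy_all_iff] that] by auto
  have 9: "word r k ^^ m = id \<longleftrightarrow> 9 dvd m" if "(r, k) \<in> {(1, 0), (1, 2), (1, 4)}" for r k m
  proof (rule word_order[where n = 9 and M = "{3}"])
    show "word r k ^^ 9 = id" by (rule id) (use that in auto)
    show "word r k ^^ q \<noteq> id" if "q \<in> {3}" for q
      by (rule nid) (use that \<open>(r, k) \<in> _\<close> in auto)
    show "m = 9" if "m dvd 9" "\<forall>q\<in>{3}. \<not> m dvd q" for m :: nat
      using that dvd_9_unique[of m] by simp
  qed
  have 6: "word r k ^^ m = id \<longleftrightarrow> 6 dvd m" if "(r, k) \<in> {(0, 1), (0, 5)}" for r k m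
  proof (rule word_order[where n = 6 and M = "{2, 3}"])
    show "word r k ^^ 6 = id" by (rule id) (use that in auto)
    show "word r k ^^ q \<noteq> id" if "q \<in> {2, 3}" for q
      by (rule nid) (use that \<open>(r, k) \<in> _\<close> in auto)
    show "m = 6" if "m dvd 6" "\<forall>q\<in>{2, 3}. \<not> m dvd q" for m :: nat
      using that dvd_6_unique[of m] by simp
  qed
  have 3: "word r k ^^ m = id \<longleftrightarrow> 3 dvd m" if "(r, k) \<in> {(3, 0), (0, 2), (0, 4)}" for r k m
  proof (rule word_order[where n = 3 and M = "{1}"])
    show "word r k ^^ 3 = id" by (rule id) (use that in auto)
    show "word r k ^^ q \<noteq> id" if "q \<in> {1}" for q
      by (rule nid) (use that \<open>(r, k) \<in> _\<close> in auto)
    show "m = 3" if "m dvd 3" "\<forall>q\<in>{1}. \<not> m dvd q" for m :: nat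
      using that dvd_3_unique[of m] by simp
  qed
  have 2: "word r k ^^ m = id \<longleftrightarrow> 2 dvd m" if "(r, k) \<in> {(0, 3)}" for r k m
  proof (rule word_order[where n = 2 and M = "{1}"])
    show "word r k ^^ 2 = id" by (rule id) (use that in auto)
    show "word r k ^^ q \<noteq> id" if "q \<in> {1}" for q
      by (rule nid) (use that \<open>(r, k) \<in> _\<close> in auto)
    show "m = 2" if "m dvd 2" "\<forall>q\<in>{1}. \<not> m dvd q" for m :: nat
      using that dvd_2_unique[of m] by simp
  qed
  show "fixed_class (word 0 0) 1" unfolding fixed_class_def word_zero by simp
  show "fixed_class (word 1 0) 9" unfolding fixed_class_def using 9 fixed_alpha by blast
  show "fixed_class (word 3 0) 3" unfolding fixed_class_def using 3 fixed_alpha_3 by blast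
  show "fixed_class (word 0 1) 6" "fixed_class (word 0 5) 6"
    unfolding fixed_class_def using 6 fixed_delta by blast+
  show "fixed_class (word 0 3) 2" unfolding fixed_class_def using 2 fixed_delta_3 by blast
  show "fixed_class (word 0 2) 3" "fixed_class (word 0 4) 3"
    unfolding fixed_class_def using 3 fixed_delta_2 by blast+
  show "fixed_class (word 1 2) 9" "fixed_class (word 1 4) 9"
    unfolding fixed_class_def using 9 fixed_alpha_delta_2 by blast+
qed

text \<open>Conjugation preserves the exponent k of \<open>delta\<close>, because the powers of
  \<open>alpha\<close> have an abelian quotient. For fixed k, conjugacy is the displayed congruence
  modulo 9 between exponents of \<open>alpha\<close>; it leaves ten classes.\<close>

lemma fixed_class_linear_stab:
  assumes "A \<in> Gam.linear_stab"
  shows "\<exists>n. fixed_class A n"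
proof -
  obtain i0 k0 where A: "A = word i0 k0" using linear_stab_words[OF assms] by blast
  define i where "i = i0 mod 9"
  define k where "k = k0 mod 6"
  have A: "A = word i k" by (simp add: A i_def k_def word_mod)
  let ?reps = "[(0, 0), (1, 0), (3, 0), (0, 1), (0, 5), (0, 3), (0, 2), (0, 4), (1, 2), (1, 4 :: nat)]"
  \<comment> \<open>\<open>word t s\<close> conjugates \<open>word i k\<close> to \<open>word r k\<close> if \<open>tab ! k ! i = (r, s, t)\<close>\<close>
  define tab :: "(nat \<times> nat \<times> nat) list list" where "tab =
     [[(0, 0, 0), (1, 0, 0), (1, 5, 0), (3, 0, 0), (1, 4, 0), (1, 1, 0), (3, 1, 0), (1, 2, 0), (1, 3, 0)],
      [(0, 0, 0), (0, 0, 1), (0, 0, 2), (0, 0, 3), (0, 0, 4), (0, 0, 5), (0, 0, 6), (0, 0, 7), (0, 0, 8)],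
      [(0, 0, 0), (1, 0, 0), (1, 1, 1), (0, 0, 1), (1, 0, 1), (1, 1, 0), (0, 0, 2), (1, 0, 2), (1, 1, 2)],
      [(0, 0, 0), (0, 0, 4), (0, 0, 8), (0, 0, 3), (0, 0, 7), (0, 0, 2), (0, 0, 6), (0, 0, 1), (0, 0, 5)],
      [(0, 0, 0), (1, 0, 0), (1, 1, 2), (0, 0, 2), (1, 0, 2), (1, 1, 0), (0, 0, 1), (1, 0, 1), (1, 1, 1)],
      [(0, 0, 0), (0, 0, 7), (0, 0, 5), (0, 0, 3), (0, 0, 1), (0, 0, 8), (0, 0, 6), (0, 0, 4), (0, 0, 2)]]"
  have tab: "lazy_all (\<lambda>i. lazy_all (\<lambda>k. case tab ! k ! i of (r, s, t) \<Rightarrow>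
      (r, k) \<in> set ?reps \<and> (t + 2 ^ s * i) mod 9 = (r + 2 ^ k * t) mod 9)
      [0, 1, 2, 3, 4, 5]) [0, 1, 2, 3, 4, 5, 6, 7, 8]"
    unfolding tab_def by simp
  have "i < 9" "k < 6" by (simp_all add: i_def k_def)
  then have ik: "i \<in> set [0, 1, 2, 3, 4, 5, 6, 7, 8]" "k \<in> set [0, 1, 2, 3, 4, 5]" by auto
  have "case tab ! k ! i of (r, s, t) \<Rightarrow>
      (r, k) \<in> set ?reps \<and> (t + 2 ^ s * i) mod 9 = (r + 2 ^ k * t) mod 9"
    by (rule bspec[OF bspec[OF tab[unfolded lazy_all_iff] ik(1)] ik(2)])
  then obtain r s t where rep: "(r, k) \<in> set ?reps"
    and cong: "(t + 2 ^ s * i) mod 9 = (r + 2 ^ k * t) mod 9"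
    by (auto simp only: split: prod.splits)
  have "word r k \<circ> word t s = word t s \<circ> A"
    unfolding A word_comp using cong by (intro word_cong) (simp_all add: add.commute)
  moreover have "\<exists>n. fixed_class (word r k) n"
    using rep fixed_class_representatives by auto
  ultimately show ?thesis using fixed_class_conjugate[OF word_stab] by blast
qed

(* Fixed-point-free automorphisms occur in all the orders 2, 4, 6, 12 and 18, not only in order 2:
   if A is an involution fixing a vertex, composing it with a translation by a coset t with
   A t \<noteq> t gives an automorphism of order 4. Hence the set of orders in the null graph case. *)
theorem theorem9:
  "let \<Gamma> = coset_graph D_minus; G = graph_aut \<Gamma> in
     order G = 2 ^ 10 * 54 \<and>
     transitive_action G (verts \<Gamma>) (\<lambda>g. g) \<and>
     (\<exists>O1 O2. orbits G (edges \<Gamma>) (\<lambda>g e. g ` e) = {O1, O2} \<and>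
        card O1 = 2 ^ 9 * 6 \<and> card O2 = 2 ^ 9 * 27) \<and>
     (\<forall>x\<in>verts \<Gamma>. type_C9_C3_C2 (G\<lparr>carrier := stabilizer G (\<lambda>g. g) x\<rparr>)) \<and>
     (\<forall>g\<in>carrier G.
        let p = group.ord G g;
            F = induced_subgraph \<Gamma> (invariants (verts \<Gamma>) (\<lambda>g. g) g)
        in graph_isomorphic F \<Gamma> \<and> p = 1
         \<or> graph_isomorphic F null_graph \<and> p \<in> {2, 4, 6, 12, 18}
         \<or> graph_isomorphic F (disjoint_copies 8 (complete_graph 4)) \<and> p = 2
         \<or> graph_isomorphic F (edgeless_graph 4) \<and> p = 3
         \<or> graph_isomorphic F (hamming_graph :: (f4 ^ 2) graph) \<and> p = 3
         \<or> graph_isomorphic F (edgeless_graph 2) \<and> p = 6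
         \<or> graph_isomorphic F (edgeless_graph 1) \<and> p = 9
         \<or> graph_isomorphic F (complete_graph 4) \<and> p = 9)"
proof -
  let ?\<Gamma> = "coset_graph D_minus"
  let ?G = "graph_aut ?\<Gamma>"
  have c4: "CARD(f4) = 4"
    unfolding UNIV_f4 by (simp add: zero_f4_def one_f4_def power2_eq_square)
  have order: "order ?G = 2 ^ 10 * 54"
    by (simp add: Gam.order_Aut card_linear_stab c4)
  have edges: "\<exists>O1 O2. orbits ?G (edges ?\<Gamma>) (\<lambda>g e. g ` e) = {O1, O2} \<and>
    card O1 = 2 ^ 9 * 6 \<and> card O2 = 2 ^ 9 * 27"
  proof (intro exI conjI)
    have "lazy_all is_point special" by code_simp
    then have sub: "set special \<subseteq> set points" by (auto simp: lazy_all_iff is_point_iff)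
    have "set special \<noteq> {}" "card (set points) \<noteq> card (set special)"
      by (simp_all add: card_points card_special) (simp add: special_def)
    then have ne: "set special \<noteq> {}" "set points - set special \<noteq> {}" using sub by auto
    show "orbits ?G (edges ?\<Gamma>) (\<lambda>g e. g ` e) =
      {Gam.edges_with_difference (set special), Gam.edges_with_difference (set points - set special)}"
    proof (rule Gam.orbits_edges)
      show "{A s | A. A \<in> Gam.linear_stab} = set special" if "s \<in> set special" for s
        using Gam.orbit_linear_stab[of s base6] that unfolding orbit_special by blast
      show "{A s | A. A \<in> Gam.linear_stab} = set points - set special"
        if "s \<in> set points - set special" for s
        using Gam.orbit_linear_stab[of s base27] that unfolding orbit_general by blast
    qed (use sub ne in auto)
    have "0 \<notin> set special" "0 \<notin> set points - set special" using sub zero_notin_points by auto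
    moreover have "card (set points - set special) = 27"
      using sub by (simp add: card_Diff_subset card_points card_special)
    ultimately show "card (Gam.edges_with_difference (set special)) = 2 ^ 9 * 6"
      "card (Gam.edges_with_difference (set points - set special)) = 2 ^ 9 * 27"
      using Gam.card_edges_with_difference[of "set special"]
        Gam.card_edges_with_difference[of "set points - set special"]
      by (simp_all add: c4 card_special)
  qed
  have stab: "\<forall>x\<in>verts ?\<Gamma>. type_C9_C3_C2 (?G\<lparr>carrier := stabilizer ?G (\<lambda>g. g) x\<rparr>)"
    using Gam.type_stabilizer[OF alpha_stab delta_stab alpha_9 delta_6 delta_alpha] card_linear_stab
      linear_stab_words unfolding word_def by blast
  have fixed: "let p = group.ord ?G g; F = induced_subgraph ?\<Gamma> (invariants (verts ?\<Gamma>) (\<lambda>g. g) g)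
        in graph_isomorphic F ?\<Gamma> \<and> p = 1
         \<or> graph_isomorphic F null_graph \<and> p \<in> {2, 4, 6, 12, 18}
         \<or> graph_isomorphic F (disjoint_copies 8 (complete_graph 4)) \<and> p = 2
         \<or> graph_isomorphic F (edgeless_graph 4) \<and> p = 3
         \<or> graph_isomorphic F (hamming_graph :: (f4 ^ 2) graph) \<and> p = 3
         \<or> graph_isomorphic F (edgeless_graph 2) \<and> p = 6
         \<or> graph_isomorphic F (edgeless_graph 1) \<and> p = 9
         \<or> graph_isomorphic F (complete_graph 4) \<and> p = 9" if "g \<in> carrier ?G" for g
  proof -
    let ?F = "induced_subgraph ?\<Gamma> (invariants (verts ?\<Gamma>) (\<lambda>g. g) g)"
    obtain A v where A: "A \<in> Gam.linear_stab" and g: "g = Gam.lift (Gam.affine_map A v)"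
      using \<open>g \<in> carrier ?G\<close> unfolding Gam.carrier_Aut by blast
    obtain n where cls: "fixed_class A n" using fixed_class_linear_stab[OF A] by blast
    then have n: "\<And>m. A ^^ m = id \<longleftrightarrow> n dvd m" by (simp add: fixed_class_def)
    show ?thesis
    proof (cases "\<exists>u. Gam.affine_map A v u = u")
      case True
      then obtain u where u: "A u + v = u" by (auto simp: Gam.affine_map_def)
      \<comment> \<open>Fixing u determines the translation part, so g is its linear part moved to
        the vertex u, with the same order and an isomorphic fixed graph.\<close>
      then have "v = u + A u" by (metis vec5_add_self_left add.commute)
      then have gu: "g = Gam.conj_translation u A" by (simp add: g Gam.conj_translation_def)
      have ord: "group.ord ?G g = n" unfolding gu by (rule Gam.ord_conj_translation[OF A n])
      have iso: "graph_isomorphic (fixed_graph A) X \<Longrightarrow> graph_isomorphic ?F X" for X :: "'x graph"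
        using Gam.induced_fixed_isomorphic[OF A, of u] graph_isomorphic_trans
        unfolding gu fixed_graph_def by blast
      have "graph_isomorphic ?F ?\<Gamma>" if "A = id"
      proof -
        have "g = Gam.lift id" using gu \<open>A = id\<close> Gam.conj_translation_id Gam.lift_one by simp
        then have "invariants (verts ?\<Gamma>) (\<lambda>g. g) g = range coset_of"
          by (simp add: Gam.invariants_lift)
        moreover have "induced_subgraph ?\<Gamma> (range coset_of) = ?\<Gamma>"
          unfolding Gam.graph_eq induced_subgraph_def by auto
        moreover have "graph_isomorphism ?\<Gamma> ?\<Gamma> id" by (simp add: graph_isomorphism_def bij_betw_def)
        ultimately show ?thesis unfolding graph_isomorphic_def by auto
      qed
      then show ?thesis
        using cls unfolding fixed_class_def Let_def ord by (elim conjE disjE) (simp_all add: iso)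
    next
      case False
      then have "invariants (verts ?\<Gamma>) (\<lambda>g. g) g = {}" by (auto simp: g Gam.invariants_lift)
      then have "graph_isomorphic ?F null_graph"
        by (simp add: graph_isomorphic_def graph_isomorphism_def induced_subgraph_def
            edgeless_graph_def graph_of_def bij_betw_def)
      moreover have "even (group.ord ?G g)" "group.ord ?G g = n \<or> group.ord ?G g = 2 * n"
        unfolding g using Gam.ord_if_no_fixed_vertex[OF A n] False by blast+
      \<comment> \<open>The even numbers among n and 2n for these n are exactly 2, 4, 6, 12 and
        18.\<close>
      moreover have "n \<in> {1, 2, 3, 6, 9}" using cls by (auto simp: fixed_class_def)
      ultimately have "graph_isomorphic ?F null_graph \<and> group.ord ?G g \<in> {2, 4, 6, 12, 18}" by auto
      then show ?thesis unfolding Let_def by blast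
    qed
  qed
  show ?thesis
    unfolding Let_def[of ?\<Gamma>] Let_def[of ?G]
    using order Gam.transitive_Aut edges stab fixed by blast
qed

end
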